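(* For any $n\ge1$, $$\sum_{\pi\in\mathfrak{S}_n(321)}t^{\mathsf{wex}\,\pi}q^{\mathsf{inv}\,\pi}=\sum_{k=1}^{\lfloor (n+1)/2\rfloor}\Big(q^{n-k}\sum_{\pi\in\widetilde{\mathfrak{S}}_{n,k-1}(231)}q^{(13\text{-}2)\pi}\Big)t^k(1+t/q)^{n+1-2k}.$$
   Context: $\mathfrak{S}_n(\tau)$: permutations of $[n]$ avoiding classical pattern $\tau$. $\mathsf{wex}\,\pi=\#\{i:\pi(i)\ge i\}$, $\mathsf{inv}\,\pi=\#\{i<j:\pi(i)>\pi(j)\}$, $\mathsf{des}\,\pi=\#\{i\in[n-1]:\pi(i)>\pi(i+1)\}$, $(13\text{-}2)\pi=\#\{(i,j):i+1<j\le n,\pi(i)<\pi(j)<\pi(i+1)\}$. $\mathsf{dd}^*\,\pi$ is the number of $i\in[n]$ with $\pi(i-1)>\pi(i)>\pi(i+1)$ under boundary $\pi(0)=\pi(n+1)=n+1$. $\widetilde{\mathfrak{S}}_{n,k}(231)=\{\pi\in\mathfrak{S}_n(231):\mathsf{dd}^*\,\pi=0,\ \mathsf{des}\,\pi=k\}$. *)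

theory Defs
  imports Main "HOL-Combinatorics.Permutations"
begin

definition contains_pattern :: "(nat \<Rightarrow> nat) \<Rightarrow> nat \<Rightarrow> nat list \<Rightarrow> bool" where
  "contains_pattern \<pi> n \<tau> \<longleftrightarrow>
     (\<exists>f :: nat \<Rightarrow> nat. strict_mono_on {0..<length \<tau>} f \<and>
        f ` {0..<length \<tau>} \<subseteq> {1..n} \<and>
        (\<forall>a<length \<tau>. \<forall>b<length \<tau>. (\<pi> (f a) < \<pi> (f b) \<longleftrightarrow> \<tau> ! a < \<tau> ! b)))"

definition avoiding_perms :: "nat \<Rightarrow> nat list \<Rightarrow> (nat \<Rightarrow> nat) set" where
  "avoiding_perms n \<tau> = {\<pi>. \<pi> permutes {1..n} \<and> \<not> contains_pattern \<pi> n \<tau>}"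

definition wex :: "nat \<Rightarrow> (nat \<Rightarrow> nat) \<Rightarrow> nat" where
  "wex n \<pi> = card {i \<in> {1..n}. \<pi> i \<ge> i}"

definition inv_stat :: "nat \<Rightarrow> (nat \<Rightarrow> nat) \<Rightarrow> nat" where
  "inv_stat n \<pi> = card {(i, j). 1 \<le> i \<and> i < j \<and> j \<le> n \<and> \<pi> i > \<pi> j}"

definition des :: "nat \<Rightarrow> (nat \<Rightarrow> nat) \<Rightarrow> nat" where
  "des n \<pi> = card {i \<in> {1..n-1}. \<pi> i > \<pi> (Suc i)}"

definition pat13_2 :: "nat \<Rightarrow> (nat \<Rightarrow> nat) \<Rightarrow> nat" where
  "pat13_2 n \<pi> = card {(i, j). 1 \<le> i \<and> i + 1 < j \<and> j \<le> n \<and> \<pi> i < \<pi> j \<and> \<pi> j < \<pi> (Suc i)}"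

definition ext_perm :: "nat \<Rightarrow> (nat \<Rightarrow> nat) \<Rightarrow> nat \<Rightarrow> nat" where
  "ext_perm n \<pi> i = (if i = 0 \<or> i = n + 1 then n + 1 else \<pi> i)"

definition dd_star :: "nat \<Rightarrow> (nat \<Rightarrow> nat) \<Rightarrow> nat" where
  "dd_star n \<pi> = card {i \<in> {1..n}. ext_perm n \<pi> (i - 1) > ext_perm n \<pi> i \<and>
                                      ext_perm n \<pi> i > ext_perm n \<pi> (i + 1)}"

definition tilde_S231 :: "nat \<Rightarrow> nat \<Rightarrow> (nat \<Rightarrow> nat) set" where
  "tilde_S231 n k = {\<pi> \<in> avoiding_perms n [2,3,1]. dd_star n \<pi> = 0 \<and> des n \<pi> = k}"

end

theory Submission
  imports Defs "HOL-Computational_Algebra.Formal_Power_Series"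
begin

text \<open>
  Appending a last entry to 321-avoiding permutations gives a generating tree with one integer
  label. The generating functions \<open>B\<^sub>c\<close> of the subtrees satisfy \<open>B\<^sub>c = (1 - X\<^sub>c) B\<^sub>c\<^sub>+\<^sub>1\<close>, where
  \<open>X\<^sub>c\<close> is expressed by the series \<open>K(t,p)\<close> in \<open>z\<close> given by
  \<open>K(t,p) = 1 + (t + p) z K(t,p) + t p q z\<^sup>2 K(tq,pq) K(t,p)\<close>. This comes down to the identity
  \<open>K(t,p) = (1 + z p K(t,p)) (1 + z t K(t,pq))\<close>, and at the root it says that the left-hand side
  is \<open>t\<close> times the coefficient of \<open>z\<^sup>n\<^sup>-\<^sup>1\<close> in \<open>K(t,q)\<close>.

  On the other side, a 231-avoiding permutation is \<open>\<sigma> n \<rho>\<close> with every entry of \<open>\<sigma>\<close> below every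
  entry of \<open>\<rho>\<close>, and it has no double descent iff \<open>\<sigma>\<close> and \<open>\<rho>\<close> have none and \<open>\<sigma>\<close> is empty only
  if \<open>\<rho>\<close> is. Weighting such a permutation by \<open>(tq)\<^sup>d (t+q)\<^sup>n\<^sup>-\<^sup>1\<^sup>-\<^sup>2\<^sup>d\<close> and \<open>q\<close> to the number
  of 13-2 patterns, where \<open>d\<close> is the number of descents, turns this decomposition into the
  recursion for the coefficients of \<open>K(t,q)\<close>.
\<close>

section \<open>The power series identity\<close>

text \<open>The theorem needs only \<open>p = q\<close>; a separate \<open>p\<close> makes the symmetry in \<open>t\<close> and \<open>p\<close>
  available, on which the factorization \<open>gamma_fps_factor\<close> rests.\<close>

fun gamma_coeff :: "'a::field \<Rightarrow> 'a \<Rightarrow> 'a \<Rightarrow> nat \<Rightarrow> 'a" where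
  "gamma_coeff q t p 0 = 1"
| "gamma_coeff q t p (Suc n) = (t + p) * gamma_coeff q t p n +
     t * p * q * (\<Sum>k<n. gamma_coeff q (t * q) (p * q) k * gamma_coeff q t p (n - 1 - k))"

declare gamma_coeff.simps(2) [simp del]

text \<open>The recursion treats \<open>t\<close> and \<open>p\<close> alike, and its inner factor
  multiplies both by \<open>q\<close>.\<close>

lemma gamma_coeff_sym: "gamma_coeff q t p n = gamma_coeff q p t n"
proof (induction n arbitrary: t p rule: less_induct)
  case (less n)
  show ?case
  proof (cases n)
    case (Suc m)
    have "(\<Sum>k<m. gamma_coeff q (t * q) (p * q) k * gamma_coeff q t p (m - 1 - k)) =
          (\<Sum>k<m. gamma_coeff q (p * q) (t * q) k * gamma_coeff q p t (m - 1 - k))"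
    proof (rule sum.cong[OF refl])
      fix k assume "k \<in> {..<m}"
      then have "k < n" "m - 1 - k < n" using Suc by auto
      then show "gamma_coeff q (t * q) (p * q) k * gamma_coeff q t p (m - 1 - k) =
          gamma_coeff q (p * q) (t * q) k * gamma_coeff q p t (m - 1 - k)"
        using less by metis
    qed
    moreover have "gamma_coeff q t p m = gamma_coeff q p t m" using less Suc by blast
    ultimately show ?thesis using Suc by (simp add: gamma_coeff.simps(2) algebra_simps)
  qed simp
qed

text \<open>Homogeneity of degree \<open>n\<close> in \<open>t\<close> and \<open>p\<close>: the
  linear term of the recursion raises the degree by one, and in the convolution \<open>t * p\<close>
  adds two to the total degree. With \<open>c = q\<close> this later removes the scaled arguments
  from the recursion.\<close>

lemma gamma_coeff_scale: "gamma_coeff q (t * c) (p * c) n = c ^ n * gamma_coeff q t p n"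
proof (induction n arbitrary: t p rule: less_induct)
  case (less n)
  show ?case
  proof (cases n)
    case (Suc m)
    have "(\<Sum>k<m. gamma_coeff q (t * c * q) (p * c * q) k * gamma_coeff q (t * c) (p * c) (m - 1 - k)) =
          (\<Sum>k<m. c ^ (m - 1) * (gamma_coeff q (t * q) (p * q) k * gamma_coeff q t p (m - 1 - k)))"
    proof (rule sum.cong[OF refl])
      fix k assume "k \<in> {..<m}"
      then have k: "k < n" "m - 1 - k < n" "k + (m - 1 - k) = m - 1" using Suc by auto
      have "gamma_coeff q (t * c * q) (p * c * q) k = c ^ k * gamma_coeff q (t * q) (p * q) k"
        using less[OF k(1), of "t * q" "p * q"] by (simp add: mult.commute mult.left_commute)
      moreover have "c ^ (m - 1) = c ^ k * c ^ (m - 1 - k)" by (metis k(3) power_add)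
      ultimately show "gamma_coeff q (t * c * q) (p * c * q) k * gamma_coeff q (t * c) (p * c) (m - 1 - k) =
          c ^ (m - 1) * (gamma_coeff q (t * q) (p * q) k * gamma_coeff q t p (m - 1 - k))"
        using less[OF k(2), of t p] by simp
    qed
    then have sm: "(\<Sum>k<m. gamma_coeff q (t * c * q) (p * c * q) k * gamma_coeff q (t * c) (p * c) (m - 1 - k)) =
        c ^ (m - 1) * (\<Sum>k<m. gamma_coeff q (t * q) (p * q) k * gamma_coeff q t p (m - 1 - k))"
      by (simp add: sum_distrib_left)
    have "gamma_coeff q (t * c) (p * c) m = c ^ m * gamma_coeff q t p m" using less Suc by blast
    moreover have "c * c ^ (m - 1) = c ^ m" if "m > 0"
      using that by (cases m) simp_all
    \<comment> \<open>For \<open>m = 0\<close> the sum is empty, so the truncated exponent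
      \<open>m - 1\<close> is harmless.\<close>
    ultimately show ?thesis unfolding Suc gamma_coeff.simps(2) sm
      by (cases "m = 0") (simp_all add: algebra_simps)
  qed simp
qed

text \<open>The series K(t,p) of the overview, with z as \<open>fps_X\<close>.\<close>

definition gamma_fps :: "'a::field \<Rightarrow> 'a \<Rightarrow> 'a \<Rightarrow> 'a fps" where
  "gamma_fps q t p = Abs_fps (gamma_coeff q t p)"

lemma gamma_fps_sym: "gamma_fps q t p = gamma_fps q p t"
  by (simp add: gamma_fps_def fps_eq_iff gamma_coeff_sym[of q t p])

text \<open>The recursion multiplied by powers of \<open>fps_X\<close> and summed. Writing it as a
  product equal to 1 exhibits one step of a continued fraction and gives \<open>algebra\<close> a
  polynomial relation to work with.\<close>

lemma gamma_fps_eq: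
  "gamma_fps q t p * (1 - fps_X * fps_const (t + p) -
     fps_const (t * p * q) * fps_X ^ 2 * gamma_fps q (t * q) (p * q)) = 1"
proof -
  have "gamma_fps q t p = 1 + fps_X * (fps_const (t + p) * gamma_fps q t p) +
     fps_X ^ 2 * (fps_const (t * p * q) * (gamma_fps q (t * q) (p * q) * gamma_fps q t p))"
    (is "?l = ?r")
  proof (rule fps_ext)
    fix n
    consider "n = 0" | "n = 1" | m where "n = Suc (Suc m)" by (metis One_nat_def not0_implies_Suc)
    then show "fps_nth ?l n = fps_nth ?r n"
    proof cases
      case 1 then show ?thesis by (simp add: gamma_fps_def)
    next
      case 2 then show ?thesis by (simp add: gamma_fps_def fps_X_power_mult_nth gamma_coeff.simps(2))
    next
      case (3 m) then show ?thesis
        by (simp add: gamma_fps_def fps_X_power_mult_nth gamma_coeff.simps(2)[of q t p "Suc m"]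
            fps_mult_nth[of "Abs_fps _" "Abs_fps _"] lessThan_Suc_atMost atMost_atLeast0)
    qed
  qed
  then show ?thesis by (simp add: algebra_simps)
qed

text \<open>The two sides differ by a series \<open>E t p\<close> with \<open>E t p = - X t G E (p q) t\<close>, where
  \<open>G = gamma_fps q t p\<close>; iterating this, \<open>E\<close> is divisible by every power of \<open>X\<close>.\<close>

lemma gamma_fps_factor:
  "gamma_fps q t p = (1 + fps_X * fps_const p * gamma_fps q t p) *
     (1 + fps_const t * fps_X * gamma_fps q t (p * q))"
proof -
  define E where "E = (\<lambda>t p. gamma_fps q t p - (1 + fps_X * fps_const p * gamma_fps q t p) *
     (1 + fps_const t * fps_X * gamma_fps q t (p * q)))"
  have E: "E t p = fps_X * (- fps_const t * (gamma_fps q t p * E (p * q) t))" for t p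
  proof -
    let ?K = "gamma_fps q t p" and ?K' = "gamma_fps q t (p * q)"
      and ?K'' = "gamma_fps q (t * q) (p * q)"
    define T P Q where "T = fps_const t" "P = fps_const p" "Q = fps_const q"
    have u: "?K * (1 - fps_X * (T + P) - T * P * Q * fps_X ^ 2 * ?K'') = 1"
      using gamma_fps_eq[of q t p] by (simp add: T_P_Q_def)
    have e1: "E t p = ?K - (1 + fps_X * P * ?K) * (1 + T * fps_X * ?K')"
      by (simp add: E_def T_P_Q_def)
    \<comment> \<open>The swapped arguments call for symmetry: \<open>gamma_fps q (p * q) t\<close>
      is \<open>?K'\<close>, and \<open>gamma_fps q (p * q) (t * q)\<close> is
      \<open>?K''\<close>.\<close>
    have e2: "E (p * q) t = ?K' - (1 + fps_X * T * ?K') * (1 + P * Q * fps_X * ?K'')"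
      by (simp add: E_def T_P_Q_def gamma_fps_sym[of q "p * q"])
    \<comment> \<open>The difference of the two sides is \<open>1 + T * fps_X * ?K'\<close> times
      the difference of the two sides of \<open>u\<close>.\<close>
    have "?K - (1 + fps_X * P * ?K) * (1 + T * fps_X * ?K') =
      fps_X * (- T * (?K * (?K' - (1 + fps_X * T * ?K') * (1 + P * Q * fps_X * ?K''))))"
      using u by algebra
    then show ?thesis using e1 e2 by (simp add: T_P_Q_def)
  qed
  have "fps_nth (E t p) n = 0" for n t p
  proof (induction n arbitrary: t p rule: less_induct)
    case (less n)
    show ?case
    proof (cases n)
      case 0 then show ?thesis by (subst E) simp
    next
      case (Suc m)
      have "fps_nth (E (p * q) t) i = 0" if "i \<le> m" for i using less that Suc by simp
      then have "fps_nth (gamma_fps q t p * E (p * q) t) m = 0"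
        unfolding fps_mult_nth by (intro sum.neutral) auto
      then show ?thesis using Suc by (subst E) (simp flip: fps_const_neg)
    qed
  qed
  then have "E t p = 0" by (intro fps_ext) simp
  then show ?thesis by (simp add: E_def)
qed

text \<open>The total weight of all paths of length \<open>n\<close> from label \<open>c\<close> in the generating tree of
  321-avoiding permutations: a permutation of \<open>{1..N}\<close> has label \<open>N - max_inv_bottom\<close>, appending
  \<open>N + 1\<close> raises the label by one, and appending \<open>v \<le> N\<close> creates \<open>N + 1 - v\<close> inversions and
  makes that number the new label.\<close>

fun tree_sum :: "'a::field \<Rightarrow> 'a \<Rightarrow> nat \<Rightarrow> nat \<Rightarrow> 'a" where
  "tree_sum q t 0 c = 1"
| "tree_sum q t (Suc n) c = t * tree_sum q t n (Suc c) + (\<Sum>j=1..c. q ^ j * tree_sum q t n j)"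

text \<open>The subtree series satisfy a system with one equation per label. A family
  \<open>B\<close> is written down and shown to solve it (\<open>B_eq\<close>). Since the unknowns
  on the right carry a factor \<open>fps_X\<close>, the system determines every coefficient, so
  those of \<open>B c\<close> are the values of \<open>tree_sum\<close> at label
  \<open>c\<close>.\<close>

lemma tree_sum_root: "tree_sum q t (Suc n) 0 = t * gamma_coeff q t q n"
proof -
  \<comment> \<open>\<open>X c\<close> stands for \<open>1 - B c / B (Suc c)\<close>. Subtracting
    consecutive equations of the system yields the recursion \<open>X_rec\<close>, which this closed
    form solves.\<close>
  define X where "X = (\<lambda>c. fps_X * fps_const (q ^ Suc c) *
     (1 + fps_const (t * q) * fps_X * gamma_fps q (t * q) (q ^ Suc (Suc c))))"
  define B where "B = rec_nat (1 + fps_const t * fps_X * gamma_fps q t q)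
     (\<lambda>c b. b * inverse (1 - X c))"
  have B0: "B 0 = 1 + fps_const t * fps_X * gamma_fps q t q"
    and "B (Suc c) = B c * inverse (1 - X c)" for c by (simp_all add: B_def)
  \<comment> \<open>\<open>X c\<close> has no constant term, so the inverses in \<open>B\<close> are
    genuine.\<close>
  have unit: "fps_nth (1 - X c) 0 \<noteq> 0" for c by (simp add: X_def)
  have BS: "B (Suc c) * (1 - X c) = B c" for c
    using inverse_mult_eq_1[OF unit[of c]] by (simp add: \<open>\<And>c. B (Suc c) = _\<close> mult.assoc)
  have nz: "1 - X c \<noteq> 0" for c using unit[of c] by (metis fps_zero_nth)
  define T Q where "T = fps_const t" "Q = fps_const q"
  \<comment> \<open>With this value the definition of \<open>B 0\<close> becomes the equation of
    label 0.\<close>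
  have B1: "B (Suc 0) = gamma_fps q t q"
  proof -
    have "gamma_fps q t q * (1 - fps_X * (T + Q) - T * Q * Q * fps_X ^ 2 * gamma_fps q (t * q) (q * q)) = 1"
      using gamma_fps_eq[of q t q] by (simp add: T_Q_def)
    then have "gamma_fps q t q * (1 - fps_X * Q * (1 + T * Q * fps_X * gamma_fps q (t * q) (q * q)))
      = 1 + T * fps_X * gamma_fps q t q" by algebra
    then have "gamma_fps q t q * (1 - X 0) = B 0"
      by (simp add: X_def B0 T_Q_def)
    then show ?thesis using BS[of 0] nz[of 0] by (metis mult_right_cancel)
  qed
  have X_rec: "X c * (1 - X (Suc c)) = fps_X * fps_const (q ^ Suc c) * (1 - X (Suc c)) + fps_X * T * X (Suc c)" for c
  proof -
    define P where "P = fps_const (q ^ Suc c)"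
    let ?K = "gamma_fps q (t * q) (q ^ Suc (Suc c))"
      and ?K' = "gamma_fps q (t * q) (q ^ Suc (Suc c) * q)"
    \<comment> \<open>Equivalently \<open>?K * (1 - X (Suc c)) = 1 + T * Q * fps_X * ?K'\<close>;
      multiplied by \<open>fps_X ^ 2 * P * T * Q\<close>, this is the claimed recursion.\<close>
    have "?K = (1 + fps_X * (P * Q) * ?K) * (1 + T * Q * fps_X * ?K')"
      using gamma_fps_factor[of q "t * q" "q ^ Suc (Suc c)"] by (simp add: T_Q_def P_def mult_ac)
    moreover have "X c = fps_X * P * (1 + T * Q * fps_X * ?K)"
      by (simp add: X_def T_Q_def P_def)
    moreover have "X (Suc c) = fps_X * (P * Q) * (1 + T * Q * fps_X * ?K')"
      by (simp add: X_def T_Q_def P_def mult_ac)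
    ultimately show ?thesis unfolding P_def[symmetric] by algebra
  qed
  have B_eq: "B c = 1 + fps_X * (T * B (Suc c) + (\<Sum>j=1..c. fps_const (q ^ j) * B j))" for c
  proof (induction c)
    case 0 show ?case by (simp add: B0 B1 T_Q_def mult_ac)
  next
    case (Suc c)
    define P where "P = fps_const (q ^ Suc c)"
    \<comment> \<open>The difference of the equations for the labels \<open>Suc c\<close> and
      \<open>c\<close>; the sums over \<open>j\<close> differ in one term only.\<close>
    have "B (Suc c) - B c = fps_X * (T * (B (Suc (Suc c)) - B (Suc c)) + P * B (Suc c))"
    proof -
      have diff: "B (Suc k) - B k = B (Suc k) * X k" for k
        unfolding BS[of k, symmetric] by (simp add: algebra_simps)
      have "B (Suc c) - B c = B (Suc c) * X c" by (rule diff)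
      also have "\<dots> = B (Suc (Suc c)) * (X c * (1 - X (Suc c)))"
        unfolding BS[of "Suc c", symmetric] by (simp add: mult_ac)
      also have "\<dots> = fps_X * (T * (B (Suc (Suc c)) * X (Suc c)) + P * (B (Suc (Suc c)) * (1 - X (Suc c))))"
        unfolding X_rec P_def by (simp add: algebra_simps)
      also have "B (Suc (Suc c)) * X (Suc c) = B (Suc (Suc c)) - B (Suc c)"
        by (rule diff[symmetric])
      finally show ?thesis using BS[of "Suc c"] by simp
    qed
    then show ?case using Suc by (simp add: P_def algebra_simps)
  qed
  have "fps_nth (B c) n = tree_sum q t n c" for n c
  proof (induction n arbitrary: c)
    case 0 show ?case by (subst B_eq) simp
  next
    case (Suc n) show ?case by (subst B_eq) (simp add: Suc T_Q_def fps_sum_nth)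
  qed
  then have "tree_sum q t (Suc n) 0 = fps_nth (B 0) (Suc n)" by simp
  also have "\<dots> = t * gamma_coeff q t q n"
    unfolding B0 by (simp add: gamma_fps_def mult.assoc)
  finally show ?thesis .
qed

section \<open>Pattern avoidance\<close>

lemma nat_less_3: "(a::nat) < 3 \<longleftrightarrow> a = 0 \<or> a = 1 \<or> a = 2" by auto

text \<open>Stated for arbitrary entries so that 321 and 231 share it. Each pair of positions occurs
  with both strict comparisons because the definition ranges over ordered pairs of indices.\<close>

lemma contains_pattern_3:
  assumes "\<tau> = [x, y, z]"
  shows "contains_pattern \<pi> n \<tau> \<longleftrightarrow> (\<exists>i j k. 1 \<le> i \<and> i < j \<and> j < k \<and> k \<le> n \<and>
    (\<pi> i < \<pi> j \<longleftrightarrow> x < y) \<and> (\<pi> j < \<pi> i \<longleftrightarrow> y < x) \<and> (\<pi> i < \<pi> k \<longleftrightarrow> x < z) \<and>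
    (\<pi> k < \<pi> i \<longleftrightarrow> z < x) \<and> (\<pi> j < \<pi> k \<longleftrightarrow> y < z) \<and> (\<pi> k < \<pi> j \<longleftrightarrow> z < y))"
    (is "_ \<longleftrightarrow> ?R")
proof
  assume "contains_pattern \<pi> n \<tau>"
  then obtain f where f: "strict_mono_on {0..<3} f" "f ` {0..<3} \<subseteq> {1..n}"
    "\<And>a b. a < 3 \<Longrightarrow> b < 3 \<Longrightarrow> \<pi> (f a) < \<pi> (f b) \<longleftrightarrow> \<tau> ! a < \<tau> ! b"
    unfolding contains_pattern_def assms by (auto simp: numeral_3_eq_3)
  have "f 0 < f 1" "f 1 < f 2" using f(1) by (auto simp: strict_mono_on_def)
  moreover have "1 \<le> f 0" "f 2 \<le> n" using f(2) by (auto simp: image_subset_iff)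
  ultimately show ?R
    using f(3)[of 0 1] f(3)[of 1 0] f(3)[of 0 2] f(3)[of 2 0] f(3)[of 1 2] f(3)[of 2 1]
    unfolding assms by (intro exI[of _ "f 0"] exI[of _ "f 1"] exI[of _ "f 2"]) simp
next
  assume ?R
  then obtain i j k where ijk: "1 \<le> i" "i < j" "j < k" "k \<le> n" 
    "\<pi> i < \<pi> j \<longleftrightarrow> x < y" "\<pi> j < \<pi> i \<longleftrightarrow> y < x" "\<pi> i < \<pi> k \<longleftrightarrow> x < z"
    "\<pi> k < \<pi> i \<longleftrightarrow> z < x" "\<pi> j < \<pi> k \<longleftrightarrow> y < z" "\<pi> k < \<pi> j \<longleftrightarrow> z < y" by blast
  define f where "f = (\<lambda>a::nat. if a = 0 then i else if a = 1 then j else k)"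
  have l: "length \<tau> = 3" using assms by simp
  have "strict_mono_on {0..<3} f" "f ` {0..<3} \<subseteq> {1..n}"
    using ijk by (auto simp: strict_mono_on_def f_def)
  moreover have "\<forall>a<3. \<forall>b<3. \<pi> (f a) < \<pi> (f b) \<longleftrightarrow> \<tau> ! a < \<tau> ! b"
    unfolding nat_less_3 using ijk assms by (auto simp: f_def)
  ultimately show "contains_pattern \<pi> n \<tau>" unfolding contains_pattern_def l by blast
qed

definition av321 :: "nat \<Rightarrow> (nat \<Rightarrow> nat) set" where "av321 n = avoiding_perms n [3,2,1]"

definition av231 :: "nat \<Rightarrow> (nat \<Rightarrow> nat) set" where "av231 n = avoiding_perms n [2,3,1]"

lemma av321_iff:
  "\<pi> \<in> av321 n \<longleftrightarrow> \<pi> permutes {1..n} \<and>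
     (\<forall>i j k. 1 \<le> i \<longrightarrow> i < j \<longrightarrow> j < k \<longrightarrow> k \<le> n \<longrightarrow> \<pi> i > \<pi> j \<longrightarrow> \<not> \<pi> j > \<pi> k)"
proof -
  have "contains_pattern \<pi> n [3,2,1] \<longleftrightarrow>
    (\<exists>i j k. 1 \<le> i \<and> i < j \<and> j < k \<and> k \<le> n \<and> \<pi> i > \<pi> j \<and> \<pi> j > \<pi> k)"
    unfolding contains_pattern_3[OF refl] by (intro iff_exI) auto
  then show ?thesis unfolding av321_def avoiding_perms_def by auto
qed

text \<open>The comparison of the second entry with the third follows from the two that are
  kept.\<close>

lemma av231_iff:
  "\<pi> \<in> av231 n \<longleftrightarrow> \<pi> permutes {1..n} \<and>
     (\<forall>i j k. 1 \<le> i \<longrightarrow> i < j \<longrightarrow> j < k \<longrightarrow> k \<le> n \<longrightarrow> \<pi> i < \<pi> j \<longrightarrow> \<not> \<pi> i > \<pi> k)"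
proof -
  have "contains_pattern \<pi> n [2,3,1] \<longleftrightarrow>
    (\<exists>i j k. 1 \<le> i \<and> i < j \<and> j < k \<and> k \<le> n \<and> \<pi> i < \<pi> j \<and> \<pi> i > \<pi> k)"
    unfolding contains_pattern_3[OF refl] by (intro iff_exI) auto
  then show ?thesis unfolding av231_def avoiding_perms_def by auto
qed

lemma finite_av321: "finite (av321 n)"
  unfolding av321_def avoiding_perms_def using finite_permutations[of "{1..n}"]
  by (rule finite_subset[rotated]) auto

section \<open>321-avoiding permutations\<close>

text \<open>In one-line notation, entries at least \<open>v\<close> move up to make room for a last
  entry \<open>v\<close>, and the relative order of the others is kept. The test on \<open>i\<close>
  leaves points outside the domain fixed, as \<open>permutes\<close> demands.\<close>

definition app_last :: "nat \<Rightarrow> (nat \<Rightarrow> nat) \<Rightarrow> nat \<Rightarrow> nat \<Rightarrow> nat" where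
  "app_last n \<pi> v i = (if i = Suc n then v else if i \<in> {1..n} \<and> v \<le> \<pi> i then Suc (\<pi> i) else \<pi> i)"

definition del_last :: "nat \<Rightarrow> (nat \<Rightarrow> nat) \<Rightarrow> nat \<Rightarrow> nat" where
  "del_last n \<pi> i = (if i = Suc n then i else if i \<in> {1..n} \<and> \<pi> (Suc n) < \<pi> i then \<pi> i - 1 else \<pi> i)"

lemma permutesI_atLeastAtMost:
  assumes "\<And>i. i \<in> {1..n} \<Longrightarrow> \<pi> i \<in> {1..n::nat}" "\<And>i. i \<notin> {1..n} \<Longrightarrow> \<pi> i = i" "inj_on \<pi> {1..n}"
  shows "\<pi> permutes {1..n}"
proof (rule bij_imp_permutes)
  have "\<pi> ` {1..n} = {1..n}" using assms by (intro endo_inj_surj) auto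
  then show "bij_betw \<pi> {1..n} {1..n}" using assms by (simp add: bij_betw_def)
qed (use assms in auto)

lemma permutes_bounds:
  assumes "\<pi> permutes {1..n::nat}" "1 \<le> i" "i \<le> n" shows "1 \<le> \<pi> i" "\<pi> i \<le> n"
  using permutes_in_image[OF assms(1), of i] assms by auto

lemma app_last_permutes:
  assumes "\<pi> permutes {1..n}" "1 \<le> v" "v \<le> Suc n"
  shows "app_last n \<pi> v permutes {1..Suc n}"
proof (rule permutesI_atLeastAtMost)
  show "app_last n \<pi> v i \<in> {1..Suc n}" if "i \<in> {1..Suc n}" for i
    using permutes_bounds[OF assms(1), of i] assms that by (auto simp: app_last_def le_Suc_eq)
  show "app_last n \<pi> v i = i" if "i \<notin> {1..Suc n}" for i
    using permutes_not_in[OF assms(1), of i] that by (auto simp: app_last_def)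
  show "inj_on (app_last n \<pi> v) {1..Suc n}"
  proof (rule inj_onI)
    fix i j assume ij: "i \<in> {1..Suc n}" "j \<in> {1..Suc n}" "app_last n \<pi> v i = app_last n \<pi> v j"
    then have "i = Suc n \<longleftrightarrow> j = Suc n" by (auto simp: app_last_def split: if_splits)
    moreover have "\<pi> i = \<pi> j" if "i \<noteq> Suc n" "j \<noteq> Suc n"
      using ij that by (auto simp: app_last_def split: if_splits)
    ultimately show "i = j" using injD[OF permutes_inj[OF assms(1)], of i j] by blast
  qed
qed

lemma del_last_permutes:
  assumes "\<pi> permutes {1..Suc n}"
  shows "del_last n \<pi> permutes {1..n}"
proof (rule permutesI_atLeastAtMost)
  have inj: "\<pi> i = \<pi> j \<Longrightarrow> i = j" for i j using permutes_inj[OF assms] by (auto simp: inj_def)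
  show "del_last n \<pi> i \<in> {1..n}" if "i \<in> {1..n}" for i
  proof -
    have "\<pi> i \<noteq> \<pi> (Suc n)" using inj[of i "Suc n"] that by auto
    then show ?thesis
      using permutes_bounds[OF assms, of i] permutes_bounds[OF assms, of "Suc n"] that by (auto simp: del_last_def)
  qed
  show "del_last n \<pi> i = i" if "i \<notin> {1..n}" for i
    using permutes_not_in[OF assms, of i] that by (auto simp: del_last_def)
  show "inj_on (del_last n \<pi>) {1..n}"
  proof (rule inj_onI)
    fix i j assume ij: "i \<in> {1..n}" "j \<in> {1..n}" "del_last n \<pi> i = del_last n \<pi> j"
    have "\<pi> i \<noteq> \<pi> (Suc n)" "\<pi> j \<noteq> \<pi> (Suc n)" using inj[of i "Suc n"] inj[of j "Suc n"] ij by auto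
    then have "\<pi> i = \<pi> j" using ij by (auto simp: del_last_def split: if_splits)
    then show "i = j" by (rule inj)
  qed
qed

lemma del_app_last:
  assumes "\<pi> permutes {1..n}"
  shows "del_last n (app_last n \<pi> v) = \<pi>"
  using permutes_not_in[OF assms, of "Suc n"] by (auto simp: fun_eq_iff del_last_def app_last_def)

lemma app_del_last:
  assumes "\<pi> permutes {1..Suc n}"
  shows "app_last n (del_last n \<pi>) (\<pi> (Suc n)) = \<pi>"
proof
  fix i
  have "i = Suc n" if "\<pi> i = \<pi> (Suc n)" using permutes_inj[OF assms] that by (auto simp: inj_def)
  then show "app_last n (del_last n \<pi>) (\<pi> (Suc n)) i = \<pi> i" 
    by (auto simp: del_last_def app_last_def)
qed

text \<open>The largest entry preceded by a greater one. The inserted 0 covers permutations without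
  inversions and makes every positive value admissible for them.\<close>

definition max_inv_bottom :: "nat \<Rightarrow> (nat \<Rightarrow> nat) \<Rightarrow> nat" where
  "max_inv_bottom n \<pi> = Max (insert 0 {\<pi> j |i j. 1 \<le> i \<and> i < j \<and> j \<le> n \<and> \<pi> i > \<pi> j})"

lemma finite_inv_bottoms: "finite {\<pi> j |i j. 1 \<le> i \<and> i < j \<and> j \<le> (n::nat) \<and> \<pi> i > (\<pi> j :: nat)}"
  by (rule finite_subset[of _ "\<pi> ` {1..n}"]) auto

lemma max_inv_bottom_less_iff:
  "max_inv_bottom n \<pi> < v \<longleftrightarrow>
     0 < v \<and> (\<forall>i j. 1 \<le> i \<longrightarrow> i < j \<longrightarrow> j \<le> n \<longrightarrow> \<pi> i > \<pi> j \<longrightarrow> \<pi> j < v)"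
  unfolding max_inv_bottom_def by (subst Max_less_iff) (use finite_inv_bottoms[of \<pi> n] in auto)

lemma max_inv_bottom_le:
  assumes "\<pi> permutes {1..n}" shows "max_inv_bottom n \<pi> \<le> n"
proof -
  have "max_inv_bottom n \<pi> < Suc n"
    unfolding max_inv_bottom_less_iff using permutes_bounds[OF assms] by (auto simp: less_Suc_eq_le)
  then show ?thesis by simp
qed

text \<open>A 321 pattern not already in \<open>\<pi>\<close> ends in the new entry, and its first
  two entries form an inversion of \<open>\<pi>\<close>. It exists iff the bottom of some inversion
  is at least \<open>v\<close>.\<close>

lemma app_last_avoiding_iff:
  assumes "\<pi> permutes {1..n}" "1 \<le> v" "v \<le> Suc n"
  shows "app_last n \<pi> v \<in> av321 (Suc n) \<longleftrightarrow>
     \<pi> \<in> av321 n \<and> max_inv_bottom n \<pi> < v"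
proof -
  have less: "app_last n \<pi> v i < app_last n \<pi> v j \<longleftrightarrow> \<pi> i < \<pi> j" if "i \<in> {1..n}" "j \<in> {1..n}" for i j
    using that by (auto simp: app_last_def)
  have less': "v < app_last n \<pi> v j \<longleftrightarrow> v \<le> \<pi> j" if "j \<in> {1..n}" for j
    using that by (auto simp: app_last_def)
  have last: "app_last n \<pi> v (Suc n) = v" by (simp add: app_last_def)
  show ?thesis (is "?A \<longleftrightarrow> ?B")
  proof
    assume A: ?A
    then have *: "\<not> app_last n \<pi> v j > app_last n \<pi> v k"
      if "1 \<le> i" "i < j" "j < k" "k \<le> Suc n" "app_last n \<pi> v i > app_last n \<pi> v j" for i j k
      using that unfolding av321_iff by blast
    have "\<not> \<pi> j > \<pi> k" if "1 \<le> i" "i < j" "j < k" "k \<le> n" "\<pi> i > \<pi> j" for i j k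
      using *[of i j k] that less[of j i] less[of k j] by auto
    moreover have "\<pi> j < v" if "1 \<le> i" "i < j" "j \<le> n" "\<pi> i > \<pi> j" for i j
      using *[of i j "Suc n"] that less[of j i] less'[of j] last by auto
    ultimately show ?B unfolding av321_iff max_inv_bottom_less_iff using assms by auto
  next
    assume B: ?B
    have "\<not> app_last n \<pi> v j > app_last n \<pi> v k"
      if h: "1 \<le> i" "i < j" "j < k" "k \<le> Suc n" "app_last n \<pi> v i > app_last n \<pi> v j" for i j k
    proof (cases "k = Suc n")
      case True
      have "\<pi> j < \<pi> i" using less[of j i] h by auto
      then have "\<pi> j < v" using B h unfolding max_inv_bottom_less_iff by auto
      then show ?thesis using True last less'[of j] h by auto
    next
      case False
      then show ?thesis using B h less[of j i] less[of k j] unfolding av321_iff by auto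
    qed
    then show ?A unfolding av321_iff using app_last_permutes[OF assms] by blast
  qed
qed

text \<open>One level of the generating tree: the children of \<open>\<pi>\<close> are its
  admissible last entries, and deleting the last entry recovers the parent.\<close>

lemma bij_betw_app_last:
  "bij_betw (\<lambda>(\<pi>, v). app_last n \<pi> v)
     (SIGMA \<pi>:av321 n. {max_inv_bottom n \<pi><..Suc n}) (av321 (Suc n))"
proof (rule bij_betw_byWitness[where f' = "\<lambda>\<pi>. (del_last n \<pi>, \<pi> (Suc n))"])
  have perm: "\<pi> \<in> av321 n \<Longrightarrow> \<pi> permutes {1..n}" for \<pi> n by (simp add: av321_iff)
  show "\<forall>a\<in>SIGMA \<pi>:av321 n. {max_inv_bottom n \<pi><..Suc n}.
    (\<lambda>\<pi>. (del_last n \<pi>, \<pi> (Suc n))) ((\<lambda>(\<pi>, v). app_last n \<pi> v) a) = a"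
    using del_app_last[OF perm] by (auto simp: app_last_def)
  show "\<forall>\<pi>\<in>av321 (Suc n).
    (\<lambda>(\<pi>, v). app_last n \<pi> v) (del_last n \<pi>, \<pi> (Suc n)) = \<pi>"
    using app_del_last[OF perm] by auto
  show "(\<lambda>(\<pi>, v). app_last n \<pi> v) ` (SIGMA \<pi>:av321 n. {max_inv_bottom n \<pi><..Suc n})
    \<subseteq> av321 (Suc n)"
    using app_last_avoiding_iff[OF perm] by auto
  show "(\<lambda>\<pi>. (del_last n \<pi>, \<pi> (Suc n))) ` av321 (Suc n)
    \<subseteq> (SIGMA \<pi>:av321 n. {max_inv_bottom n \<pi><..Suc n})"
  proof (intro image_subsetI)
    fix \<pi> assume \<pi>: "\<pi> \<in> av321 (Suc n)"
    have v: "1 \<le> \<pi> (Suc n)" "\<pi> (Suc n) \<le> Suc n" using permutes_bounds[OF perm[OF \<pi>]] by auto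
    show "(del_last n \<pi>, \<pi> (Suc n)) \<in> (SIGMA \<pi>:av321 n. {max_inv_bottom n \<pi><..Suc n})"
      using app_last_avoiding_iff[OF del_last_permutes[OF perm[OF \<pi>]] v]
        app_del_last[OF perm[OF \<pi>]] \<pi> v by simp
  qed
qed

section \<open>Effect of an appended entry on the statistics\<close>

text \<open>Pigeonhole: otherwise the \<open>i - 1\<close> earlier entries would all lie among the
  \<open>\<pi> i - 1\<close> smaller values, which are too few.\<close>

lemma inversion_of_deficiency:
  assumes "\<pi> permutes {1..n::nat}" "i \<in> {1..n}" "\<pi> i < i"
  shows "\<exists>j. 1 \<le> j \<and> j < i \<and> \<pi> i < \<pi> j"
proof (rule ccontr)
  assume no: "\<not> ?thesis"
  have "\<pi> ` {1..<i} \<subseteq> {1..<\<pi> i}"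
  proof (rule image_subsetI)
    fix j assume j: "j \<in> {1..<i}"
    then have "\<pi> j \<noteq> \<pi> i" using injD[OF permutes_inj[OF assms(1)], of j i] by auto
    moreover have "\<pi> j \<le> \<pi> i" using no j by auto
    ultimately show "\<pi> j \<in> {1..<\<pi> i}" using permutes_bounds[OF assms(1), of j] j assms(2) by auto
  qed
  then have "card {1..<i} \<le> card {1..<\<pi> i}"
    using card_inj_on_le[OF permutes_inj_on[OF assms(1)]] by blast
  then show False using assms permutes_bounds[OF assms(1), of i] by auto
qed

text \<open>Raising an entry could only spoil a deficiency, but a deficiency is the bottom of an
  inversion, hence below \<open>v\<close> and not raised. The new position counts only if
  \<open>v = Suc n\<close>.\<close>

lemma wex_app_last:
  assumes "\<pi> permutes {1..n}" "max_inv_bottom n \<pi> < v" "v \<le> Suc n"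
  shows "wex (Suc n) (app_last n \<pi> v) = (if v = Suc n then Suc (wex n \<pi>) else wex n \<pi>)"
proof -
  have "app_last n \<pi> v i \<ge> i \<longleftrightarrow> \<pi> i \<ge> i" if "i \<in> {1..n}" for i
  proof (cases "\<pi> i < i")
    case True
    then have "\<pi> i < v" using inversion_of_deficiency[OF assms(1) that True] assms(2) that
      unfolding max_inv_bottom_less_iff by auto
    then show ?thesis using that by (auto simp: app_last_def)
  qed (use that in \<open>auto simp: app_last_def\<close>)
  moreover have last: "app_last n \<pi> v (Suc n) = v" by (simp add: app_last_def)
  ultimately have "{i \<in> {1..Suc n}. app_last n \<pi> v i \<ge> i} =
     (if v = Suc n then insert (Suc n) {i \<in> {1..n}. \<pi> i \<ge> i} else {i \<in> {1..n}. \<pi> i \<ge> i})"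
    using assms(3) last by (auto simp: le_Suc_eq)
  then show ?thesis by (simp add: wex_def)
qed

lemma card_permutes_ge:
  assumes "\<pi> permutes {1..n}" "1 \<le> v" "v \<le> Suc n"
  shows "card {i \<in> {1..n}. v \<le> \<pi> i} = Suc n - v"
proof -
  have "\<pi> ` {i \<in> {1..n}. v \<le> \<pi> i} = {v..n}"
  proof
    show "{v..n} \<subseteq> \<pi> ` {i \<in> {1..n}. v \<le> \<pi> i}"
    proof
      fix x assume "x \<in> {v..n}"
      then have "x \<in> \<pi> ` {1..n}" using permutes_image[OF assms(1)] assms(2) by auto
      then show "x \<in> \<pi> ` {i \<in> {1..n}. v \<le> \<pi> i}" using \<open>x \<in> {v..n}\<close> by auto
    qed
  qed (use permutes_bounds[OF assms(1)] in auto)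
  moreover have "card (\<pi> ` {i \<in> {1..n}. v \<le> \<pi> i}) = card {i \<in> {1..n}. v \<le> \<pi> i}"
    by (rule card_image[OF permutes_inj_on[OF assms(1)]])
  ultimately show ?thesis by simp
qed

text \<open>The new inversions pair the last position with the entries that were raised.\<close>

lemma inv_stat_app_last:
  assumes "\<pi> permutes {1..n}" "1 \<le> v" "v \<le> Suc n"
  shows "inv_stat (Suc n) (app_last n \<pi> v) = inv_stat n \<pi> + (Suc n - v)"
proof -
  let ?A = "{(i, j). 1 \<le> i \<and> i < j \<and> j \<le> n \<and> \<pi> i > \<pi> j}"
  let ?B = "(\<lambda>i. (i, Suc n)) ` {i \<in> {1..n}. v \<le> \<pi> i}"
  have "{(i, j). 1 \<le> i \<and> i < j \<and> j \<le> Suc n \<and> app_last n \<pi> v i > app_last n \<pi> v j} = ?A \<union> ?B"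
    by (auto simp: app_last_def le_Suc_eq image_iff split: if_splits)
  moreover have "finite ?A" by (rule finite_subset[of _ "{1..n} \<times> {1..n}"]) auto
  moreover have "?A \<inter> ?B = {}" by auto
  moreover have "card ?B = Suc n - v"
    unfolding card_permutes_ge[OF assms, symmetric] by (rule card_image) (simp add: inj_on_def)
  ultimately show ?thesis by (simp add: inv_stat_def card_Un_disjoint)
qed

text \<open>Old inversion bottoms lie below \<open>v\<close> and keep their values. If
  \<open>v \<le> n\<close>, some entry was raised above \<open>v\<close>, so \<open>v\<close> is
  itself a bottom and the largest one.\<close>

lemma max_inv_bottom_app_last:
  assumes "\<pi> permutes {1..n}" "max_inv_bottom n \<pi> < v" "v \<le> Suc n"
  shows "max_inv_bottom (Suc n) (app_last n \<pi> v) = (if v = Suc n then max_inv_bottom n \<pi> else v)"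
proof -
  let ?I = "{\<pi> j |i j. 1 \<le> i \<and> i < j \<and> j \<le> n \<and> \<pi> i > \<pi> j}"
  have bot: "\<pi> j < v" if "1 \<le> i" "i < j" "j \<le> n" "\<pi> j < \<pi> i" for i j
    using assms(2) that unfolding max_inv_bottom_less_iff by auto
  have I: "{app_last n \<pi> v j |i j. 1 \<le> i \<and> i < j \<and> j \<le> Suc n \<and> app_last n \<pi> v i > app_last n \<pi> v j} =
     ?I \<union> {v |i. i \<in> {1..n} \<and> v \<le> \<pi> i}" (is "?l = ?r")
  proof
    have less: "app_last n \<pi> v i < app_last n \<pi> v j \<longleftrightarrow> \<pi> i < \<pi> j" if "i \<in> {1..n}" "j \<in> {1..n}" for i j
      using that by (auto simp: app_last_def)
    have eq: "app_last n \<pi> v j = \<pi> j" if "1 \<le> i" "i < j" "j \<le> n" "\<pi> j < \<pi> i" for i j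
      using bot[OF that] that by (auto simp: app_last_def)
    show "?l \<subseteq> ?r"
    proof
      fix x assume "x \<in> ?l"
      then obtain i j where x: "x = app_last n \<pi> v j" and ij: "1 \<le> i" "i < j" "j \<le> Suc n"
        "app_last n \<pi> v i > app_last n \<pi> v j" by blast
      show "x \<in> ?r"
      proof (cases "j = Suc n")
        case True then show ?thesis using x ij by (auto simp: app_last_def split: if_splits)
      next
        case False
        then have "j \<le> n" "\<pi> j < \<pi> i" using ij less[of j i] by auto
        then show ?thesis using x eq[of i j] ij by auto
      qed
    qed
    show "?r \<subseteq> ?l"
    proof
      fix x assume "x \<in> ?r"
      then consider i j where "x = \<pi> j" "1 \<le> i" "i < j" "j \<le> n" "\<pi> j < \<pi> i"
        | i where "x = v" "i \<in> {1..n}" "v \<le> \<pi> i" by blast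
      then show "x \<in> ?l"
      proof cases
        case 1
        then have "x = app_last n \<pi> v j" "1 \<le> i" "i < j" "j \<le> Suc n"
          "app_last n \<pi> v i > app_last n \<pi> v j" using eq[of i j] less[of j i] by auto
        then show ?thesis by blast
      next
        case 2
        then have "x = app_last n \<pi> v (Suc n)" "1 \<le> i" "i < Suc n" "Suc n \<le> Suc n"
          "app_last n \<pi> v i > app_last n \<pi> v (Suc n)" by (auto simp: app_last_def)
        then show ?thesis by blast
      qed
    qed
  qed
  show ?thesis
  proof (cases "v = Suc n")
    case True
    then have "{v |i. i \<in> {1..n} \<and> v \<le> \<pi> i} = {}" using permutes_bounds[OF assms(1)] by fastforce
    then show ?thesis unfolding max_inv_bottom_def I if_P[OF True] by (simp only: Un_empty_right)
  next
    case False
    then have "v \<in> \<pi> ` {1..n}" using permutes_image[OF assms(1)] assms(2,3) by auto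
    then have "{v |i. i \<in> {1..n} \<and> v \<le> \<pi> i} = {v}" by auto
    then have "max_inv_bottom (Suc n) (app_last n \<pi> v) = Max (insert 0 (?I \<union> {v}))"
      unfolding max_inv_bottom_def I by simp
    also have "\<dots> = v" 
      by (rule Max_eqI) (use finite_inv_bottoms[of \<pi> n] bot in \<open>auto intro: less_imp_le\<close>)
    finally show ?thesis using False by simp
  qed
qed

text \<open>The recursion of \<open>tree_sum\<close> read off at a node of label
  \<open>n - max_inv_bottom n \<pi>\<close>: the child \<open>v = Suc n\<close> gives the term with
  factor \<open>t\<close>, and the children \<open>v \<le> n\<close> give the sum over
  \<open>j = Suc n - v\<close>.\<close>

lemma sum_app_last:
  fixes q t :: "'a::field"
  assumes "\<pi> \<in> av321 n"
  shows "(\<Sum>v\<in>{max_inv_bottom n \<pi><..Suc n}. t ^ wex (Suc n) (app_last n \<pi> v) *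
      q ^ inv_stat (Suc n) (app_last n \<pi> v) *
      tree_sum q t m (Suc n - max_inv_bottom (Suc n) (app_last n \<pi> v))) =
    t ^ wex n \<pi> * q ^ inv_stat n \<pi> * tree_sum q t (Suc m) (n - max_inv_bottom n \<pi>)"
    (is "sum ?f _ = ?W * _")
proof -
  have perm: "\<pi> permutes {1..n}" using assms by (simp add: av321_iff)
  let ?b = "max_inv_bottom n \<pi>"
  have b: "?b \<le> n" using max_inv_bottom_le[OF perm] .
  have "?f (Suc n) = ?W * (t * tree_sum q t m (Suc (n - ?b)))"
    using b wex_app_last[OF perm, of "Suc n"] inv_stat_app_last[OF perm, of "Suc n"]
      max_inv_bottom_app_last[OF perm, of "Suc n"] by (simp add: Suc_diff_le)
  moreover have "sum ?f {?b<..n} = (\<Sum>v\<in>{?b<..n}. ?W * (q ^ (Suc n - v) * tree_sum q t m (Suc n - v)))"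
  proof (rule sum.cong[OF refl])
    fix v assume "v \<in> {?b<..n}"
    then show "?f v = ?W * (q ^ (Suc n - v) * tree_sum q t m (Suc n - v))"
      using wex_app_last[OF perm, of v] inv_stat_app_last[OF perm, of v]
        max_inv_bottom_app_last[OF perm, of v]
      by (simp add: power_add del: Nat.add_diff_assoc Nat.diff_diff_right)
  qed
  moreover have "(\<Sum>v\<in>{?b<..n}. q ^ (Suc n - v) * tree_sum q t m (Suc n - v)) =
      (\<Sum>j=1..n - ?b. q ^ j * tree_sum q t m j)"
    by (rule sum.reindex_bij_witness[of _ "\<lambda>j. Suc n - j" "\<lambda>v. Suc n - v"]) auto
  moreover have "{?b<..Suc n} = insert (Suc n) {?b<..n}" using b by auto
  ultimately show ?thesis by (simp add: sum_distrib_left[symmetric] distrib_left)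
qed

text \<open>The first \<open>n\<close> levels are enumerated by permutations and the remaining
  \<open>m\<close> by \<open>tree_sum\<close>. Each induction step moves one level from the latter
  to the former, so \<open>m\<close> must vary; \<open>m = 0\<close> gives the left-hand side of the
  theorem.\<close>

lemma sum_av321:
  fixes q t :: "'a::field"
  shows "(\<Sum>\<pi>\<in>av321 n. t ^ wex n \<pi> * q ^ inv_stat n \<pi> *
      tree_sum q t m (n - max_inv_bottom n \<pi>)) = tree_sum q t (n + m) 0"
proof (induction n arbitrary: m)
  case 0
  have "av321 0 = {id}" by (auto simp: av321_iff)
  moreover have "{(i, j). 1 \<le> i \<and> i < j \<and> j \<le> (0::nat) \<and> id i > id j} = {}" by auto
  then have "inv_stat 0 id = 0" unfolding inv_stat_def by (metis card.empty)
  ultimately show ?case by (simp add: wex_def del: id_apply)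
next
  case (Suc n)
  have "(\<Sum>\<pi>\<in>av321 (Suc n). t ^ wex (Suc n) \<pi> * q ^ inv_stat (Suc n) \<pi> *
      tree_sum q t m (Suc n - max_inv_bottom (Suc n) \<pi>)) =
    (\<Sum>(\<pi>, v)\<in>(SIGMA \<pi>:av321 n. {max_inv_bottom n \<pi><..Suc n}).
      t ^ wex (Suc n) (app_last n \<pi> v) * q ^ inv_stat (Suc n) (app_last n \<pi> v) *
      tree_sum q t m (Suc n - max_inv_bottom (Suc n) (app_last n \<pi> v)))"
    by (subst sum.reindex_bij_betw[OF bij_betw_app_last, symmetric]) (simp add: case_prod_unfold)
  also have "\<dots> = (\<Sum>\<pi>\<in>av321 n. t ^ wex n \<pi> * q ^ inv_stat n \<pi> *
      tree_sum q t (Suc m) (n - max_inv_bottom n \<pi>))"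
    by (subst sum.Sigma[symmetric]) (auto simp: finite_av321 sum_app_last simp del: tree_sum.simps)
  also have "\<dots> = tree_sum q t (n + Suc m) 0" by (rule Suc)
  finally show ?case by simp
qed

section \<open>231-avoiding permutations without double descents\<close>

text \<open>The word \<open>\<sigma> n \<rho>\<close> of the overview, with
  \<open>n = Suc (a + b)\<close> and \<open>\<rho>\<close> shifted up by \<open>a\<close>.\<close>

definition glue :: "nat \<Rightarrow> nat \<Rightarrow> (nat \<Rightarrow> nat) \<Rightarrow> (nat \<Rightarrow> nat) \<Rightarrow> nat \<Rightarrow> nat" where
  "glue a b \<sigma> \<rho> i = (if i \<le> a then \<sigma> i else if i = Suc a then Suc (a + b)
     else if i \<le> Suc (a + b) then a + \<rho> (i - Suc a) else i)"

lemma glue_left [simp]: "i \<le> a \<Longrightarrow> glue a b \<sigma> \<rho> i = \<sigma> i"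
  and glue_mid [simp]: "glue a b \<sigma> \<rho> (Suc a) = Suc (a + b)"
  and glue_right: "1 \<le> j \<Longrightarrow> j \<le> b \<Longrightarrow> glue a b \<sigma> \<rho> (Suc a + j) = a + \<rho> j"
  by (auto simp: glue_def)

lemma glue_cases:
  assumes "1 \<le> i" "i \<le> Suc (a + b)"
  obtains "i \<le> a" | "i = Suc a" | j where "i = Suc a + j" "1 \<le> j" "j \<le> b"
proof (cases "i \<le> Suc a")
  case False
  with that(3)[of "i - Suc a"] assms show ?thesis by auto
qed (use that in fastforce)

lemma glue_permutes:
  assumes "\<sigma> permutes {1..a}" "\<rho> permutes {1..b}"
  shows "glue a b \<sigma> \<rho> permutes {1..Suc (a + b)}"
proof (rule permutesI_atLeastAtMost)
  note s = permutes_bounds[OF assms(1)] and r = permutes_bounds[OF assms(2)]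
  show "glue a b \<sigma> \<rho> i \<in> {1..Suc (a + b)}" if i: "i \<in> {1..Suc (a + b)}" for i
  proof -
    have i': "1 \<le> i" "i \<le> Suc (a + b)" using i by auto
    show ?thesis using i'
    proof (cases rule: glue_cases)
      case 1 then show ?thesis using s[of i] i' by simp
    next
      case (3 j) then show ?thesis using r[of j] by (simp add: glue_right del: add_Suc)
    qed simp
  qed
  show "glue a b \<sigma> \<rho> i = i" if "i \<notin> {1..Suc (a + b)}" for i
    using that permutes_not_in[OF assms(1), of i] by (auto simp: glue_def)
  show "inj_on (glue a b \<sigma> \<rho>) {1..Suc (a + b)}"
  proof (rule linorder_inj_onI)
    fix i k assume ik: "i < k" "i \<in> {1..Suc (a + b)}" "k \<in> {1..Suc (a + b)}"
    have i': "1 \<le> i" "i \<le> Suc (a + b)" and k': "1 \<le> k" "k \<le> Suc (a + b)" using ik by auto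
    show "glue a b \<sigma> \<rho> i \<noteq> glue a b \<sigma> \<rho> k" using k'
    proof (cases rule: glue_cases)
      case 1
      then show ?thesis using ik injD[OF permutes_inj[OF assms(1)], of i k] by auto
    next
      case 2
      then show ?thesis using ik s[of i] by auto
    next
      case (3 j)
      note j = 3
      show ?thesis using i'
      proof (cases rule: glue_cases)
        case 1 then show ?thesis using s[of i] r[of j] i' j by (auto simp: glue_right simp del: add_Suc)
      next
        case 2 then show ?thesis using r[of j] j by (auto simp: glue_right simp del: add_Suc)
      next
        case (3 l) then show ?thesis using ik j injD[OF permutes_inj[OF assms(2)], of l j]
          by (auto simp: glue_right simp del: add_Suc)
      qed
    qed
  qed auto
qed

text \<open>No 231 pattern meets two blocks. Its last entry is the smallest, so it cannot be the
  maximum; if it lies in the right block, the first entry is neither in the lower left block nor the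
  maximum, which has nothing above it.\<close>

lemma glue_av231_iff:
  assumes "\<sigma> permutes {1..a}" "\<rho> permutes {1..b}"
  shows "glue a b \<sigma> \<rho> \<in> av231 (Suc (a + b)) \<longleftrightarrow> \<sigma> \<in> av231 a \<and> \<rho> \<in> av231 b"
proof
  note s = permutes_bounds[OF assms(1)] and r = permutes_bounds[OF assms(2)]
  let ?g = "glue a b \<sigma> \<rho>"
  {
    assume "?g \<in> av231 (Suc (a + b))"
    then have g: "\<not> ?g i > ?g k"
      if "1 \<le> i" "i < j" "j < k" "k \<le> Suc (a + b)" "?g i < ?g j" for i j k
      using that unfolding av231_iff by blast
    have "\<not> \<sigma> i > \<sigma> k" if "1 \<le> i" "i < j" "j < k" "k \<le> a" "\<sigma> i < \<sigma> j" for i j k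
      using g[of i j k] that by simp
    moreover have "\<not> \<rho> i > \<rho> k" if "1 \<le> i" "i < j" "j < k" "k \<le> b" "\<rho> i < \<rho> j" for i j k
      using g[of "Suc a + i" "Suc a + j" "Suc a + k"] that by (simp add: glue_right del: add_Suc)
    ultimately show "\<sigma> \<in> av231 a \<and> \<rho> \<in> av231 b" unfolding av231_iff using assms by blast
  next
    assume av: "\<sigma> \<in> av231 a \<and> \<rho> \<in> av231 b"
    have "\<not> ?g i > ?g k" if h: "1 \<le> i" "i < j" "j < k" "k \<le> Suc (a + b)" "?g i < ?g j" for i j k
    proof -
      have k': "1 \<le> k" and i': "i \<le> Suc (a + b)" using h by auto
      from k' h(4) show ?thesis
      proof (cases rule: glue_cases)
        case 1
        then show ?thesis using av h unfolding av231_iff by auto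
      next
        case 2
        then show ?thesis using s[of i] h by auto
      next
        case (3 k')
        note k' = 3
        from h(1) i' show ?thesis
        proof (cases rule: glue_cases)
          case 1
          then show ?thesis using s[of i] h k' by (simp add: glue_right del: add_Suc)
        next
          case 2
          have "?g j \<le> Suc (a + b)"
            using permutes_bounds[OF glue_permutes[OF assms], of j] h by simp
          then show ?thesis using 2 h by simp
        next
          case (3 i')
          define j' where "j' = j - Suc a"
          have "j = Suc a + j'" "i' < j'" "j' < k'" using 3 k' h by (auto simp: j'_def)
          then show ?thesis using 3 k' h av unfolding av231_iff by (auto simp: glue_right simp del: add_Suc)
        qed
      qed
    qed
    then show "?g \<in> av231 (Suc (a + b))" unfolding av231_iff using glue_permutes[OF assms] by blast
  }
qed

definition left_part :: "nat \<Rightarrow> (nat \<Rightarrow> nat) \<Rightarrow> nat \<Rightarrow> nat" where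
  "left_part a \<pi> i = (if i \<le> a then \<pi> i else i)"

definition right_part :: "nat \<Rightarrow> nat \<Rightarrow> (nat \<Rightarrow> nat) \<Rightarrow> nat \<Rightarrow> nat" where
  "right_part a b \<pi> i = (if i \<in> {1..b} then \<pi> (Suc a + i) - a else i)"

text \<open>An entry before the maximum that exceeds one after it would form a 231 pattern with the
  maximum in the middle. So the first \<open>a\<close> entries are the \<open>a\<close> smallest
  values.\<close>

lemma av231_split:
  assumes "\<pi> \<in> av231 (Suc (a + b))" "\<pi> (Suc a) = Suc (a + b)"
  shows "left_part a \<pi> permutes {1..a}" "right_part a b \<pi> permutes {1..b}"
    "glue a b (left_part a \<pi>) (right_part a b \<pi>) = \<pi>"
proof -
  let ?n = "Suc (a + b)"
  have perm: "\<pi> permutes {1..?n}" using assms(1) by (simp add: av231_iff)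
  have inj: "\<pi> i = \<pi> j \<longleftrightarrow> i = j" for i j using permutes_inj[OF perm] by (auto simp: inj_def)
  note bounds = permutes_bounds[OF perm]
  have less: "\<pi> i < \<pi> k" if "1 \<le> i" "i \<le> a" "Suc a < k" "k \<le> ?n" for i k
  proof -
    have "\<pi> i < \<pi> (Suc a)" using bounds[of i] inj[of i "Suc a"] that assms(2) by auto
    then have "\<not> \<pi> i > \<pi> k" using assms(1) that unfolding av231_iff
      by (metis less_Suc_eq_le)
    then show ?thesis using inj[of i k] that by auto
  qed
  have left: "\<pi> i \<le> a" if i: "1 \<le> i" "i \<le> a" for i
  proof -
    \<comment> \<open>Values at positions after \<open>Suc a\<close> exceed \<open>\<pi> i\<close>,
      so all values up to \<open>\<pi> i\<close> occur among the first \<open>a\<close> positions;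
      counting bounds \<open>\<pi> i\<close> by \<open>a\<close>.\<close>
    have "{1..\<pi> i} \<subseteq> \<pi> ` {1..a}"
    proof
      fix v assume v: "v \<in> {1..\<pi> i}"
      then have "v \<in> \<pi> ` {1..?n}" using permutes_image[OF perm] bounds[of i] i by auto
      then obtain k where k: "k \<in> {1..?n}" "v = \<pi> k" by blast
      have "\<not> Suc a < k" using less[of i k] k v i by auto
      moreover have "\<pi> i \<noteq> \<pi> (Suc a)" using inj[of i "Suc a"] i by auto
      then have "\<pi> i < \<pi> (Suc a)" using bounds[of i] i assms(2) by auto
      then have "k \<noteq> Suc a" using k v by auto
      ultimately show "v \<in> \<pi> ` {1..a}" using k by auto
    qed
    then have "card {1..\<pi> i} \<le> card (\<pi> ` {1..a})" by (intro card_mono) auto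
    also have "\<dots> \<le> a" using card_image_le[of "{1..a}" \<pi>] by simp
    finally show ?thesis by simp
  qed
  show L: "left_part a \<pi> permutes {1..a}"
  proof (rule permutesI_atLeastAtMost)
    show "left_part a \<pi> i \<in> {1..a}" if "i \<in> {1..a}" for i
      using left[of i] bounds[of i] that by (auto simp: left_part_def)
    show "left_part a \<pi> i = i" if "i \<notin> {1..a}" for i
      using that permutes_not_in[OF perm, of i] by (auto simp: left_part_def)
    show "inj_on (left_part a \<pi>) {1..a}" by (auto simp: inj_on_def left_part_def inj)
  qed
  have right: "a < \<pi> k" "\<pi> k \<le> a + b" if k: "Suc a < k" "k \<le> ?n" for k
  proof -
    have "\<pi> ` {1..a} = {1..a}"
      by (rule endo_inj_surj) (use left bounds in \<open>auto simp: inj_on_def inj\<close>)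
    then have "\<pi> k \<notin> {1..a}" using k inj_image_mem_iff[OF permutes_inj[OF perm], of k "{1..a}"] by simp
    then show "a < \<pi> k" using bounds[of k] k by auto
    show "\<pi> k \<le> a + b" using bounds[of k] inj[of k "Suc a"] assms(2) k by auto
  qed
  show R: "right_part a b \<pi> permutes {1..b}"
  proof (rule permutesI_atLeastAtMost)
    show "right_part a b \<pi> i \<in> {1..b}" if "i \<in> {1..b}" for i
      using right[of "Suc a + i"] that by (auto simp: right_part_def)
    show "inj_on (right_part a b \<pi>) {1..b}"
    proof (rule inj_onI)
      fix i j assume ij: "i \<in> {1..b}" "j \<in> {1..b}" "right_part a b \<pi> i = right_part a b \<pi> j"
      then have "\<pi> (Suc a + i) = \<pi> (Suc a + j)"
        using right(1)[of "Suc a + i"] right(1)[of "Suc a + j"] by (simp add: right_part_def)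
      then show "i = j" using inj by simp
    qed
  qed (auto simp: right_part_def)
  show "glue a b (left_part a \<pi>) (right_part a b \<pi>) = \<pi>"
  proof
    fix i
    consider "i \<le> a" | "i = Suc a" | "Suc a < i" "i \<le> ?n" | "i > ?n" by linarith
    then show "glue a b (left_part a \<pi>) (right_part a b \<pi>) i = \<pi> i"
    proof cases
      case 3
      then obtain j where j: "i = Suc a + j" "1 \<le> j" "j \<le> b"
        by (intro that[of "i - Suc a"]) auto
      then show ?thesis using right(1)[OF 3] by (simp add: glue_right right_part_def del: add_Suc)
    next
      case 4
      then show ?thesis using permutes_not_in[OF perm, of i] by (simp add: glue_def)
    qed (simp_all add: assms left_part_def)
  qed
qed

lemma left_part_glue: "\<sigma> permutes {1..a} \<Longrightarrow> left_part a (glue a b \<sigma> \<rho>) = \<sigma>"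
  by (auto simp: left_part_def fun_eq_iff permutes_not_in)

lemma right_part_glue: "\<rho> permutes {1..b} \<Longrightarrow> right_part a b (glue a b \<sigma> \<rho>) = \<rho>"
  by (auto simp: right_part_def fun_eq_iff permutes_not_in glue_right simp del: add_Suc)

section \<open>Double descents under the decomposition at the maximum\<close>

text \<open>The union of the sets \<open>tilde_S231 n k\<close> over all \<open>k\<close>.\<close>

definition dd_free :: "nat \<Rightarrow> (nat \<Rightarrow> nat) set" where
  "dd_free n = {\<pi> \<in> av231 n. dd_star n \<pi> = 0}"

definition dd_at :: "nat \<Rightarrow> (nat \<Rightarrow> nat) \<Rightarrow> nat \<Rightarrow> bool" where
  "dd_at n \<pi> i \<longleftrightarrow> ext_perm n \<pi> (i - 1) > ext_perm n \<pi> i \<and> ext_perm n \<pi> i > ext_perm n \<pi> (i + 1)"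

lemma dd_free_iff: "\<pi> \<in> dd_free n \<longleftrightarrow> \<pi> \<in> av231 n \<and> (\<forall>i\<in>{1..n}. \<not> dd_at n \<pi> i)"
  by (auto simp: dd_free_def dd_star_def dd_at_def)

lemma dd_free_permutes: "\<pi> \<in> dd_free n \<Longrightarrow> \<pi> permutes {1..n}"
  by (simp add: dd_free_iff av231_iff)

lemma finite_dd_free: "finite (dd_free n)"
  by (rule finite_subset[OF _ finite_permutations[of "{1..n}"]]) (auto dest: dd_free_permutes)

text \<open>The maximum acts as the boundary value at the right end of \<open>\<sigma>\<close> and
  at the left end of \<open>\<rho>\<close>. It is a double descent itself only when the outer
  boundary value precedes it directly and \<open>\<rho>\<close> follows.\<close>

lemma dd_at_glue:
  assumes "\<sigma> permutes {1..a}" "\<rho> permutes {1..b}"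
  shows "1 \<le> i \<Longrightarrow> i \<le> a \<Longrightarrow> dd_at (Suc (a + b)) (glue a b \<sigma> \<rho>) i \<longleftrightarrow> dd_at a \<sigma> i"
    and "dd_at (Suc (a + b)) (glue a b \<sigma> \<rho>) (Suc a) \<longleftrightarrow> a = 0 \<and> 1 \<le> b"
    and "1 \<le> j \<Longrightarrow> j \<le> b \<Longrightarrow>
      dd_at (Suc (a + b)) (glue a b \<sigma> \<rho>) (Suc a + j) \<longleftrightarrow> dd_at b \<rho> j"
proof -
  note s = permutes_bounds[OF assms(1)] and r = permutes_bounds[OF assms(2)]
  let ?n = "Suc (a + b)" and ?g = "glue a b \<sigma> \<rho>"
  show "dd_at ?n ?g i \<longleftrightarrow> dd_at a \<sigma> i" if i: "1 \<le> i" "i \<le> a"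
  proof -
    have "ext_perm ?n ?g i = \<sigma> i" "ext_perm a \<sigma> i = \<sigma> i" using i by (auto simp: ext_perm_def)
    moreover have "ext_perm ?n ?g (i - 1) > \<sigma> i \<longleftrightarrow> ext_perm a \<sigma> (i - 1) > \<sigma> i"
      using i s[of i] by (auto simp: ext_perm_def)
    moreover have "\<sigma> i > ext_perm ?n ?g (i + 1) \<longleftrightarrow> \<sigma> i > ext_perm a \<sigma> (i + 1)"
      using i s[of i] by (cases "i = a") (auto simp: ext_perm_def)
    ultimately show ?thesis by (simp add: dd_at_def)
  qed
  show "dd_at ?n ?g (Suc a) \<longleftrightarrow> a = 0 \<and> 1 \<le> b"
  proof -
    have "ext_perm ?n ?g (Suc a) = ?n" by (simp add: ext_perm_def)
    moreover have "ext_perm ?n ?g a > ?n \<longleftrightarrow> a = 0" using s[of a] by (auto simp: ext_perm_def)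
    moreover have "?n > ext_perm ?n ?g (Suc a + 1) \<longleftrightarrow> 1 \<le> b"
      using glue_right[of 1 b a \<sigma> \<rho>] r[of 1] by (auto simp: ext_perm_def)
    ultimately show ?thesis by (simp add: dd_at_def)
  qed
  show "dd_at ?n ?g (Suc a + j) \<longleftrightarrow> dd_at b \<rho> j" if j: "1 \<le> j" "j \<le> b"
  proof -
    have "ext_perm ?n ?g (Suc a + j) = a + \<rho> j" "ext_perm b \<rho> j = \<rho> j"
      using j by (simp_all add: ext_perm_def glue_right del: add_Suc)
    moreover have "ext_perm ?n ?g (Suc a + j - 1) > a + \<rho> j \<longleftrightarrow> ext_perm b \<rho> (j - 1) > \<rho> j"
    proof (cases "j = 1")
      case True then show ?thesis using r[of j] j by (auto simp: ext_perm_def)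
    next
      case False
      then obtain l where "j = Suc l" "1 \<le> l" using j by (cases j) auto
      then show ?thesis using j glue_right[of l b a \<sigma> \<rho>] by (simp add: ext_perm_def)
    qed
    moreover have "a + \<rho> j > ext_perm ?n ?g (Suc a + j + 1) \<longleftrightarrow> \<rho> j > ext_perm b \<rho> (j + 1)"
    proof (cases "j = b")
      case True then show ?thesis using r[of j] j by (auto simp: ext_perm_def)
    next
      case False
      then show ?thesis using j glue_right[of "Suc j" b a \<sigma> \<rho>] by (simp add: ext_perm_def)
    qed
    ultimately show ?thesis by (simp add: dd_at_def)
  qed
qed

lemma glue_dd_free_iff:
  assumes "\<sigma> permutes {1..a}" "\<rho> permutes {1..b}"
  shows "glue a b \<sigma> \<rho> \<in> dd_free (Suc (a + b)) \<longleftrightarrow>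
    \<sigma> \<in> dd_free a \<and> \<rho> \<in> dd_free b \<and> (1 \<le> a \<or> b = 0)"
proof -
  have "(\<forall>i\<in>{1..Suc (a + b)}. \<not> dd_at (Suc (a + b)) (glue a b \<sigma> \<rho>) i) \<longleftrightarrow>
    (\<forall>i\<in>{1..a}. \<not> dd_at a \<sigma> i) \<and> (\<forall>i\<in>{1..b}. \<not> dd_at b \<rho> i) \<and> (1 \<le> a \<or> b = 0)"
    (is "?A \<longleftrightarrow> ?B")
  proof
    assume A: ?A
    have "\<not> dd_at a \<sigma> i" if "i \<in> {1..a}" for i using A dd_at_glue(1)[OF assms, of i] that by auto
    moreover have "\<not> dd_at b \<rho> i" if "i \<in> {1..b}" for i
      using bspec[OF A, of "Suc a + i"] dd_at_glue(3)[OF assms, of i] that by auto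
    moreover have "1 \<le> a \<or> b = 0" using bspec[OF A, of "Suc a"] dd_at_glue(2)[OF assms] by auto
    ultimately show ?B by blast
  next
    assume B: ?B
    show ?A
    proof
      fix i assume "i \<in> {1..Suc (a + b)}"
      then have i: "1 \<le> i" "i \<le> Suc (a + b)" by auto
      then show "\<not> dd_at (Suc (a + b)) (glue a b \<sigma> \<rho>) i"
      proof (cases rule: glue_cases)
        case 1 then show ?thesis using B i dd_at_glue(1)[OF assms, of i] by auto
      next
        case 2 then show ?thesis using B dd_at_glue(2)[OF assms] by auto
      next
        case (3 j) then show ?thesis using B dd_at_glue(3)[OF assms, of j] by auto
      qed
    qed
  qed
  then show ?thesis unfolding dd_free_iff glue_av231_iff[OF assms] by blast
qed

text \<open>Permutations are cut at the maximum, in position \<open>Suc a\<close>. The range starts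
  at 1 because an empty left part would force an empty right part, contradicting
  \<open>1 \<le> m\<close>.\<close>

lemma bij_betw_glue:
  assumes "1 \<le> m"
  shows "bij_betw (\<lambda>(a, \<sigma>, \<rho>). glue a (m - a) \<sigma> \<rho>)
     (SIGMA a:{1..m}. dd_free a \<times> dd_free (m - a)) (dd_free (Suc m))"
proof (rule bij_betw_imageI)
  let ?D = "SIGMA a:{1..m}. dd_free a \<times> dd_free (m - a)"
  let ?f = "\<lambda>(a, \<sigma>, \<rho>). glue a (m - a) \<sigma> \<rho>"
  show "inj_on ?f ?D"
  proof (rule inj_onI)
    fix x y assume xy: "x \<in> ?D" "y \<in> ?D" "?f x = ?f y"
    obtain a \<sigma> \<rho> where x: "x = (a, \<sigma>, \<rho>)" by (metis prod_cases3)
    obtain a' \<sigma>' \<rho>' where y: "y = (a', \<sigma>', \<rho>')" by (metis prod_cases3)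
    have p: "\<sigma> permutes {1..a}" "\<rho> permutes {1..m - a}" "\<sigma>' permutes {1..a'}" "\<rho>' permutes {1..m - a'}"
      and a: "a \<le> m" "a' \<le> m"
      using xy dd_free_permutes unfolding x y by auto
    have eq: "glue a (m - a) \<sigma> \<rho> = glue a' (m - a') \<sigma>' \<rho>'" using xy x y by simp
    \<comment> \<open>The position of the maximum determines \<open>a\<close>.\<close>
    have "glue a (m - a) \<sigma> \<rho> (Suc a) = Suc m" "glue a' (m - a') \<sigma>' \<rho>' (Suc a') = Suc m" using a by simp_all
    then have "glue a (m - a) \<sigma> \<rho> (Suc a) = glue a (m - a) \<sigma> \<rho> (Suc a')" using eq by simp
    then have aa: "a = a'" using injD[OF permutes_inj[OF glue_permutes[OF p(1,2)]]] by blast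
    have "\<sigma> = \<sigma>'" using eq aa left_part_glue p by metis
    moreover have "\<rho> = \<rho>'" using eq aa right_part_glue p by metis
    ultimately show "x = y" using x y aa by simp
  qed
  show "?f ` ?D = dd_free (Suc m)"
  proof
    have "glue a (m - a) \<sigma> \<rho> \<in> dd_free (Suc m)"
      if "a \<in> {1..m}" "\<sigma> \<in> dd_free a" "\<rho> \<in> dd_free (m - a)" for a \<sigma> \<rho>
      using glue_dd_free_iff[OF dd_free_permutes[OF that(2)] dd_free_permutes[OF that(3)]] that by simp
    then show "?f ` ?D \<subseteq> dd_free (Suc m)" by auto
    show "dd_free (Suc m) \<subseteq> ?f ` ?D"
    proof
      fix \<pi> assume pi: "\<pi> \<in> dd_free (Suc m)"
      then have "Suc m \<in> \<pi> ` {1..Suc m}" using permutes_image[OF dd_free_permutes] by auto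
      then obtain p where p: "1 \<le> p" "p \<le> Suc m" "\<pi> p = Suc m" by auto
      define a where "a = p - 1"
      have a: "a \<le> m" "Suc a = p" "Suc (a + (m - a)) = Suc m" using p by (auto simp: a_def)
      have "\<pi> \<in> av231 (Suc (a + (m - a)))" "\<pi> (Suc a) = Suc (a + (m - a))"
        using pi p a by (simp_all add: dd_free_iff)
      note sp = av231_split[OF this]
      have "left_part a \<pi> \<in> dd_free a" "right_part a (m - a) \<pi> \<in> dd_free (m - a)" "1 \<le> a \<or> m - a = 0"
        using glue_dd_free_iff[OF sp(1,2)] pi sp(3) a by auto
      then have "(a, left_part a \<pi>, right_part a (m - a) \<pi>) \<in> ?D" using a assms by auto
      moreover have "\<pi> = ?f (a, left_part a \<pi>, right_part a (m - a) \<pi>)" using sp(3) by simp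
      ultimately show "\<pi> \<in> ?f ` ?D" by blast
    qed
  qed
qed

section \<open>Descents and 13-2 patterns under the decomposition\<close>

text \<open>The maximum is never the lower end of a descent, and it starts one iff something follows
  it.\<close>

lemma des_glue:
  assumes "\<sigma> permutes {1..a}" "\<rho> permutes {1..b}"
  shows "des (Suc (a + b)) (glue a b \<sigma> \<rho>) = des a \<sigma> + des b \<rho> + (if b = 0 then 0 else 1)"
proof -
  note s = permutes_bounds[OF assms(1)] and r = permutes_bounds[OF assms(2)]
  let ?n = "Suc (a + b)" and ?g = "glue a b \<sigma> \<rho>"
  let ?A = "{i \<in> {1..a-1}. \<sigma> i > \<sigma> (Suc i)}"
  let ?B = "{i \<in> {1..b-1}. \<rho> i > \<rho> (Suc i)}"
  let ?M = "if b = 0 then {} else {Suc a}"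
  have right: "?g (Suc a + j) > ?g (Suc (Suc a + j)) \<longleftrightarrow> \<rho> j > \<rho> (Suc j)" if "1 \<le> j" "Suc j \<le> b" for j
    using that glue_right[of j b a \<sigma> \<rho>] glue_right[of "Suc j" b a \<sigma> \<rho>] by simp
  have mid: "?g (Suc a) > ?g (Suc (Suc a))" if "1 \<le> b"
    using that glue_right[of 1 b a \<sigma> \<rho>] r[of 1] by simp
  have "{i \<in> {1..?n-1}. ?g i > ?g (Suc i)} = ?A \<union> ?M \<union> (+) (Suc a) ` ?B" (is "?l = ?r")
  proof
    show "?l \<subseteq> ?r"
    proof
      fix i assume "i \<in> ?l"
      then have i: "1 \<le> i" "i \<le> a + b" "?g i > ?g (Suc i)" by auto
      from i(1) le_SucI[OF i(2)] show "i \<in> ?r"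
      proof (cases rule: glue_cases)
        case 1
        then have "i < a" using i s[of i] by (cases "i = a") auto
        then show ?thesis using i by auto
      next
        case 2
        then show ?thesis using i by auto
      next
        case (3 j)
        then have "j \<in> ?B" using right[of j] i by auto
        then show ?thesis using 3 by blast
      qed
    qed
    have "i \<in> ?l" if "i \<in> ?A" for i using that by auto
    moreover have "i \<in> ?l" if "i \<in> ?M" for i using that mid by (auto split: if_splits)
    moreover have "Suc a + j \<in> ?l" if "j \<in> ?B" for j using that right[of j] by auto
    ultimately show "?r \<subseteq> ?l" by blast
  qed
  moreover have "card (?A \<union> ?M \<union> (+) (Suc a) ` ?B) = card ?A + card ?M + card ((+) (Suc a) ` ?B)"
    by (subst card_Un_disjoint, simp, simp, force)+ simp
  moreover have "card ((+) (Suc a) ` ?B) = card ?B" by (rule card_image) (simp add: inj_on_def)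
  ultimately show ?thesis by (simp add: des_def)
qed

text \<open>An occurrence meeting more than one block uses the ascent from the last entry of
  \<open>\<sigma>\<close> to the maximum as 13 and any entry of \<open>\<rho>\<close> as 2, which
  gives \<open>b\<close> of them.\<close>

lemma pat13_2_glue:
  assumes "\<sigma> permutes {1..a}" "\<rho> permutes {1..b}" "1 \<le> a"
  shows "pat13_2 (Suc (a + b)) (glue a b \<sigma> \<rho>) = pat13_2 a \<sigma> + pat13_2 b \<rho> + b"
proof -
  note s = permutes_bounds[OF assms(1)] and r = permutes_bounds[OF assms(2)]
  let ?n = "Suc (a + b)" and ?g = "glue a b \<sigma> \<rho>"
  let ?P = "\<lambda>n \<pi>. {(i, j). 1 \<le> i \<and> i + 1 < j \<and> j \<le> n \<and> \<pi> i < \<pi> j \<and> \<pi> j < \<pi> (Suc i)} :: (nat \<times> nat) set"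
  let ?M = "(\<lambda>j. (a, Suc a + j)) ` {1..b}"
  let ?R = "(\<lambda>(i, j). (Suc a + i, Suc a + j)) ` ?P b \<rho>"
  have fin: "finite (?P n \<pi>)" for n :: nat and \<pi> :: "nat \<Rightarrow> nat"
    by (rule finite_subset[of _ "{1..n} \<times> {1..n}"]) auto
  have "?P ?n ?g = ?P a \<sigma> \<union> ?M \<union> ?R" (is "?l = ?r")
  proof
    show "?l \<subseteq> ?r"
    proof (rule subrelI)
      fix i j assume "(i, j) \<in> ?l"
      then have ij: "1 \<le> i" "i + 1 < j" "j \<le> ?n" "?g i < ?g j" "?g j < ?g (Suc i)" by auto
      have i': "i \<le> ?n" and j': "1 \<le> j" using ij by auto
      from j' ij(3) show "(i, j) \<in> ?r"
      proof (cases rule: glue_cases)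
        case 1 then show ?thesis using ij by auto
      next
        case 2
        then show ?thesis using ij permutes_bounds[OF glue_permutes[OF assms(1,2)], of "Suc i"] by auto
      next
        case (3 j')
        note j' = 3
        from ij(1) i' show ?thesis
        proof (cases rule: glue_cases)
          case 1
          then have "i = a" using ij s[of "Suc i"] j' r[of j'] glue_right[of j' b a \<sigma> \<rho>] by (cases "i = a") auto
          then show ?thesis using j' by auto
        next
          case 2
          then show ?thesis using ij permutes_bounds[OF glue_permutes[OF assms(1,2)], of j] by auto
        next
          case (3 i')
          then have "(i', j') \<in> ?P b \<rho>"
            using ij j' glue_right[of j' b a \<sigma> \<rho>] glue_right[of i' b a \<sigma> \<rho>] glue_right[of "Suc i'" b a \<sigma> \<rho>] by auto
          then have "(Suc a + i', Suc a + j') \<in> ?R" by (rule rev_image_eqI) simp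
          then show ?thesis unfolding 3(1) j'(1) by blast
        qed
      qed
    qed
    show "?r \<subseteq> ?l"
    proof (intro Un_least)
      show "?P a \<sigma> \<subseteq> ?l" by auto
      show "?M \<subseteq> ?l"
      proof (rule image_subsetI)
        fix j assume "j \<in> {1..b}"
        then show "(a, Suc a + j) \<in> ?l"
          using s[of a] r[of j] assms(3) glue_right[of j b a \<sigma> \<rho>] by auto
      qed
      show "?R \<subseteq> ?l"
      proof (rule image_subsetI)
        fix x assume "x \<in> ?P b \<rho>"
        then obtain i j where "x = (i, j)" "1 \<le> i" "i + 1 < j" "j \<le> b" "\<rho> i < \<rho> j" "\<rho> j < \<rho> (Suc i)"
          by auto
        then show "(case x of (i, j) \<Rightarrow> (Suc a + i, Suc a + j)) \<in> ?l"
          using glue_right[of j b a \<sigma> \<rho>] glue_right[of i b a \<sigma> \<rho>] glue_right[of "Suc i" b a \<sigma> \<rho>] by auto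
      qed
    qed
  qed
  moreover have "card (?P a \<sigma> \<union> ?M \<union> ?R) = card (?P a \<sigma>) + card ?M + card ?R"
  proof -
    have "?P a \<sigma> \<inter> ?M = {}" "(?P a \<sigma> \<union> ?M) \<inter> ?R = {}" by auto
    moreover have "finite ?M" "finite ?R" using fin[of b \<rho>] by (intro finite_imageI, simp)+
    ultimately show ?thesis using fin[of a \<sigma>] by (simp only: card_Un_disjoint finite_UnI)
  qed
  moreover have "card ?R = card (?P b \<rho>)" by (rule card_image) (auto simp: inj_on_def)
  moreover have "card ?M = b" by (subst card_image) (auto simp: inj_on_def)
  ultimately show ?thesis unfolding pat13_2_def by simp
qed

lemma dd_free_0: "dd_free 0 = {id}" and dd_free_1: "dd_free (Suc 0) = {id}"
proof -
  show "dd_free 0 = {id}" by (auto simp: dd_free_iff av231_iff)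
  have "id \<in> dd_free (Suc 0)" by (auto simp: dd_free_iff av231_iff permutes_id dd_at_def ext_perm_def)
  moreover have "\<pi> = id" if "\<pi> \<in> dd_free (Suc 0)" for \<pi>
    using dd_free_permutes[OF that] by (simp add: permutes_sing)
  ultimately show "dd_free (Suc 0) = {id}" by auto
qed

text \<open>In the decomposition the left part is nonempty; if the right part is too, the bounds of
  the parts add up with the one new descent. Thus the exponent
  \<open>n - 1 - 2 * des n \<pi>\<close> is a true difference, and \<open>k\<close> ends at
  \<open>(n + 1) div 2\<close>.\<close>

lemma des_dd_free_bound: "\<pi> \<in> dd_free n \<Longrightarrow> 1 \<le> n \<Longrightarrow> 2 * des n \<pi> + 1 \<le> n"
proof (induction n arbitrary: \<pi> rule: less_induct)
  case (less n)
  show ?case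
  proof (cases "n = 1")
    case True then show ?thesis by (simp add: des_def)
  next
    case False
    then obtain m where m: "n = Suc m" "1 \<le> m" using less.prems by (cases n) auto
    then have "\<pi> \<in> (\<lambda>(a, \<sigma>, \<rho>). glue a (m - a) \<sigma> \<rho>) ` (SIGMA a:{1..m}. dd_free a \<times> dd_free (m - a))"
      using bij_betw_imp_surj_on[OF bij_betw_glue[OF m(2)]] less.prems by simp
    then obtain a \<sigma> \<rho> where a: "1 \<le> a" "a \<le> m" and d: "\<sigma> \<in> dd_free a" "\<rho> \<in> dd_free (m - a)"
      and \<pi>: "\<pi> = glue a (m - a) \<sigma> \<rho>" by auto
    have *: "des n \<pi> = des a \<sigma> + des (m - a) \<rho> + (if m - a = 0 then 0 else 1)"
      using des_glue[OF d[THEN dd_free_permutes]] a m \<pi> by simp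
    have "2 * des a \<sigma> + 1 \<le> a" using less.IH[OF _ d(1)] a m by simp
    moreover have "2 * des (m - a) \<rho> + 1 \<le> m - a" if "m - a \<noteq> 0" using less.IH[OF _ d(2)] a m that by simp
    moreover have "des (m - a) \<rho> = 0" if "m - a = 0" using that by (simp add: des_def)
    ultimately show ?thesis using * m a by (cases "m - a = 0") auto
  qed
qed

section \<open>The weighted count of permutations without double descents\<close>

text \<open>For \<open>n \<ge> 1\<close>, \<open>q \<noteq> 0\<close> and \<open>\<pi>\<close> in
  \<open>dd_free n\<close>, \<open>t\<close> times this weight is the contribution of
  \<open>\<pi>\<close> to the right-hand side of the theorem, cleared of the division by
  \<open>q\<close>.\<close>

definition dd_weight :: "'a::field \<Rightarrow> 'a \<Rightarrow> nat \<Rightarrow> (nat \<Rightarrow> nat) \<Rightarrow> 'a" where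
  "dd_weight q t n \<pi> = (t * q) ^ des n \<pi> * (t + q) ^ (n - 1 - 2 * des n \<pi>) * q ^ pat13_2 n \<pi>"

lemma pat13_2_0: "pat13_2 0 \<pi> = 0"
proof -
  have "{(i, j). 1 \<le> i \<and> i + 1 < j \<and> j \<le> 0 \<and> \<pi> i < \<pi> j \<and> \<pi> j < \<pi> (Suc i)} = {}" by auto
  then show ?thesis unfolding pat13_2_def by (metis card.empty)
qed

text \<open>If \<open>b = 0\<close>, the size grows by one without a new descent, which gives one
  more factor \<open>t + q\<close>. Otherwise the new descent gives \<open>t * q\<close>, the
  exponents of \<open>t + q\<close> add up, and \<open>q ^ b\<close> comes from the straddling
  patterns.\<close>

lemma dd_weight_glue:
  assumes "\<sigma> \<in> dd_free a" "\<rho> \<in> dd_free b" "1 \<le> a"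
  shows "dd_weight q t (Suc (a + b)) (glue a b \<sigma> \<rho>) =
    (if b = 0 then (t + q) * dd_weight q t a \<sigma>
     else t * q * q ^ b * (dd_weight q t a \<sigma> * dd_weight q t b \<rho>))"
proof -
  note p = assms(1,2)[THEN dd_free_permutes]
  note des = des_glue[OF p] and pat = pat13_2_glue[OF p assms(3)]
  have A: "2 * des a \<sigma> + 1 \<le> a" using des_dd_free_bound assms by blast
  show ?thesis
  proof (cases "b = 0")
    case True
    have "des b \<rho> = 0" using True by (simp add: des_def)
    moreover have "a - 2 * des a \<sigma> = Suc (a - 1 - 2 * des a \<sigma>)" using A by simp
    ultimately show ?thesis using True des pat by (simp add: dd_weight_def pat13_2_0)
  next
    case False
    then have B: "2 * des b \<rho> + 1 \<le> b" using des_dd_free_bound assms by simp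
    have "Suc (a + b) - 1 - 2 * (des a \<sigma> + des b \<rho> + 1) = (a - 1 - 2 * des a \<sigma>) + (b - 1 - 2 * des b \<rho>)"
      using A B by simp
    then show ?thesis using False unfolding dd_weight_def des pat
      by (simp add: power_add mult_ac)
  qed
qed

text \<open>Summed over the decomposition, the weights satisfy the recursion of
  \<open>gamma_coeff\<close> at \<open>p = q\<close>: \<open>a = m\<close> gives its linear term and
  \<open>a < m\<close> its convolution.\<close>

lemma sum_dd_free: "(\<Sum>\<pi>\<in>dd_free (Suc m). dd_weight q t (Suc m) \<pi>) = gamma_coeff q t q m"
proof (induction m rule: less_induct)
  case (less m)
  let ?H = "\<lambda>n. \<Sum>\<pi>\<in>dd_free n. dd_weight q t n \<pi>"
  show ?case
  proof (cases m)
    case 0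
    have "{(i, j). 1 \<le> i \<and> i + 1 < j \<and> j \<le> Suc 0 \<and> id i < id j \<and> id j < id (Suc i)} = {}" by auto
    then have "pat13_2 (Suc 0) id = 0" unfolding pat13_2_def by (metis card.empty)
    then show ?thesis using 0 by (simp add: dd_free_1 dd_weight_def des_def del: id_apply)
  next
    case (Suc r)
    have "?H (Suc m) = (\<Sum>(a, \<sigma>, \<rho>)\<in>(SIGMA a:{1..m}. dd_free a \<times> dd_free (m - a)).
        dd_weight q t (Suc m) (glue a (m - a) \<sigma> \<rho>))"
      using Suc by (subst sum.reindex_bij_betw[OF bij_betw_glue, symmetric]) (auto simp: case_prod_unfold)
    also have "\<dots> = (\<Sum>a=1..m. \<Sum>(\<sigma>, \<rho>)\<in>dd_free a \<times> dd_free (m - a).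
        dd_weight q t (Suc m) (glue a (m - a) \<sigma> \<rho>))"
      by (subst sum.Sigma) (auto simp: finite_dd_free)
    also have "\<dots> = (\<Sum>a=1..m. if a = m then (t + q) * ?H m else t * q * q ^ (m - a) * (?H a * ?H (m - a)))"
    proof (rule sum.cong[OF refl])
      fix a assume a: "a \<in> {1..m}"
      have w: "dd_weight q t (Suc m) (glue a (m - a) \<sigma> \<rho>) =
        (if a = m then (t + q) * dd_weight q t a \<sigma>
         else t * q * q ^ (m - a) * (dd_weight q t a \<sigma> * dd_weight q t (m - a) \<rho>))"
        if "(\<sigma>, \<rho>) \<in> dd_free a \<times> dd_free (m - a)" for \<sigma> \<rho>
        using dd_weight_glue[of \<sigma> a \<rho> "m - a" q t] that a by (auto split: if_splits)
      have "(\<Sum>(\<sigma>, \<rho>)\<in>dd_free a \<times> dd_free (m - a). dd_weight q t (Suc m) (glue a (m - a) \<sigma> \<rho>)) =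
        (\<Sum>(\<sigma>, \<rho>)\<in>dd_free a \<times> dd_free (m - a). if a = m then (t + q) * dd_weight q t a \<sigma>
         else t * q * q ^ (m - a) * (dd_weight q t a \<sigma> * dd_weight q t (m - a) \<rho>))"
        using w by (intro sum.cong) auto
      \<comment> \<open>For \<open>a = m\<close> the right part ranges over the single element of
        \<open>dd_free 0\<close>.\<close>
      also have "\<dots> = (if a = m then (t + q) * ?H m else t * q * q ^ (m - a) * (?H a * ?H (m - a)))"
        by (simp add: sum.cartesian_product[symmetric] dd_free_0 sum_distrib_left[symmetric] sum_product)
      finally show "(\<Sum>(\<sigma>, \<rho>)\<in>dd_free a \<times> dd_free (m - a). dd_weight q t (Suc m) (glue a (m - a) \<sigma> \<rho>)) =
        (if a = m then (t + q) * ?H m else t * q * q ^ (m - a) * (?H a * ?H (m - a)))" .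
    qed
    also have "\<dots> = (t + q) * ?H m + (\<Sum>a=1..r. t * q * q ^ (m - a) * (?H a * ?H (m - a)))"
      using Suc by (simp add: add.commute)
    \<comment> \<open>Put \<open>k = r - a\<close>, so the right part has size \<open>k + 1\<close>.
      Of its \<open>q ^ (k + 1)\<close>, the factor \<open>q ^ k\<close> is absorbed by homogeneity
      into the scaled arguments of \<open>gamma_coeff\<close>.\<close>
    also have "(\<Sum>a=1..r. t * q * q ^ (m - a) * (?H a * ?H (m - a))) =
      (\<Sum>k<r. t * q * q * (q ^ k * gamma_coeff q t q k * gamma_coeff q t q (r - 1 - k)))"
    proof (rule sum.reindex_bij_witness[of _ "\<lambda>k. r - k" "\<lambda>a. r - a"])
      fix a assume a: "a \<in> {1..r}"
      then have "m - a = Suc (r - a)" "a = Suc (r - 1 - (r - a))" using Suc by auto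
      then have "?H (m - a) = gamma_coeff q t q (r - a)" "?H a = gamma_coeff q t q (r - 1 - (r - a))"
        using less.IH[of "r - a"] less.IH[of "r - 1 - (r - a)"] Suc a by auto
      then show "t * q * q * (q ^ (r - a) * gamma_coeff q t q (r - a) * gamma_coeff q t q (r - 1 - (r - a))) =
        t * q * q ^ (m - a) * (?H a * ?H (m - a))" using \<open>m - a = Suc (r - a)\<close> by (simp add: mult_ac)
    qed auto
    also have "?H m = gamma_coeff q t q r" using less.IH[of r] Suc by simp
    finally show ?thesis unfolding Suc
      by (simp add: gamma_coeff.simps(2) gamma_coeff_scale sum_distrib_left)
  qed
qed

theorem theorem4p3:
  fixes t q :: "'a :: field" and n :: nat
  assumes "n \<ge> 1" and "q \<noteq> 0"
  shows "(\<Sum>\<pi>\<in>avoiding_perms n [3,2,1]. t ^ wex n \<pi> * q ^ inv_stat n \<pi>) =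
         (\<Sum>k = 1..(n + 1) div 2.
            (q ^ (n - k) * (\<Sum>\<pi>\<in>tilde_S231 n (k - 1). q ^ pat13_2 n \<pi>))
            * t ^ k * (1 + t / q) ^ (n + 1 - 2 * k))"
proof -
  obtain m where m: "n = Suc m" using assms(1) by (cases n) auto
  let ?T = "\<lambda>k \<pi>. q ^ (n - k) * q ^ pat13_2 n \<pi> * t ^ k * (1 + t / q) ^ (n + 1 - 2 * k)"
  have "(\<Sum>\<pi>\<in>avoiding_perms n [3,2,1]. t ^ wex n \<pi> * q ^ inv_stat n \<pi>) = tree_sum q t n 0"
    using sum_av321[of t n q 0] unfolding av321_def by simp
  also have "\<dots> = (\<Sum>\<pi>\<in>dd_free n. t * dd_weight q t n \<pi>)"
    unfolding m tree_sum_root sum_dd_free[symmetric] sum_distrib_left ..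
  also have "\<dots> = (\<Sum>\<pi>\<in>dd_free n. ?T (Suc (des n \<pi>)) \<pi>)"
  proof (rule sum.cong[OF refl])
    fix \<pi> assume "\<pi> \<in> dd_free n"
    then have d: "2 * des n \<pi> + 1 \<le> n" using des_dd_free_bound assms by blast
    define e where "e = n - 1 - 2 * des n \<pi>"
    \<comment> \<open>With \<open>k = des n \<pi> + 1\<close>, the power \<open>q ^ (n - k)\<close>
      splits: \<open>q ^ des n \<pi>\<close> joins the power of \<open>t\<close>, and
      \<open>q ^ e\<close> turns \<open>(1 + t / q) ^ e\<close> into
      \<open>(t + q) ^ e\<close>.\<close>
    have e: "n - Suc (des n \<pi>) = des n \<pi> + e" "n + 1 - 2 * Suc (des n \<pi>) = e"
      using d by (auto simp: e_def)
    have "q ^ e * (1 + t / q) ^ e = (t + q) ^ e"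
      using assms(2) by (simp add: power_mult_distrib[symmetric] distrib_left add.commute)
    moreover have "?T (Suc (des n \<pi>)) \<pi> =
      t * ((t * q) ^ des n \<pi> * (q ^ e * (1 + t / q) ^ e) * q ^ pat13_2 n \<pi>)"
      unfolding e by (simp add: power_add power_mult_distrib mult_ac)
    ultimately show "t * dd_weight q t n \<pi> = ?T (Suc (des n \<pi>)) \<pi>"
      unfolding dd_weight_def e_def[symmetric] by (simp only:)
  qed
  \<comment> \<open>Grouping by \<open>k = des n \<pi> + 1\<close>; the descent bound keeps
    \<open>k\<close> in this range.\<close>
  also have "\<dots> = (\<Sum>k = 1..(n + 1) div 2. \<Sum>\<pi>\<in>{\<pi> \<in> dd_free n. Suc (des n \<pi>) = k}. ?T (Suc (des n \<pi>)) \<pi>)"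
  proof (rule sum.group[symmetric])
    show "(\<lambda>\<pi>. Suc (des n \<pi>)) ` dd_free n \<subseteq> {1..(n + 1) div 2}"
      using des_dd_free_bound assms by fastforce
  qed (auto simp: finite_dd_free)
  also have "\<dots> = (\<Sum>k = 1..(n + 1) div 2.
            (q ^ (n - k) * (\<Sum>\<pi>\<in>tilde_S231 n (k - 1). q ^ pat13_2 n \<pi>))
            * t ^ k * (1 + t / q) ^ (n + 1 - 2 * k))"
  proof (rule sum.cong[OF refl])
    fix k assume "k \<in> {1..(n + 1) div 2}"
    then have "{\<pi> \<in> dd_free n. Suc (des n \<pi>) = k} = tilde_S231 n (k - 1)"
      by (auto simp: dd_free_def tilde_S231_def av231_def)
    moreover have "(\<Sum>\<pi>\<in>{\<pi> \<in> dd_free n. Suc (des n \<pi>) = k}. ?T (Suc (des n \<pi>)) \<pi>) =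
      (\<Sum>\<pi>\<in>{\<pi> \<in> dd_free n. Suc (des n \<pi>) = k}. ?T k \<pi>)"
      by (rule sum.cong) auto
    ultimately show "(\<Sum>\<pi>\<in>{\<pi> \<in> dd_free n. Suc (des n \<pi>) = k}. ?T (Suc (des n \<pi>)) \<pi>) =
      (q ^ (n - k) * (\<Sum>\<pi>\<in>tilde_S231 n (k - 1). q ^ pat13_2 n \<pi>))
            * t ^ k * (1 + t / q) ^ (n + 1 - 2 * k)"
      by (simp only: sum_distrib_left sum_distrib_right)
  qed
  finally show ?thesis .
qed

end
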